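(* Let $k\ge 1$ be an integer and let $G$ be a graph with $m$ edges and degeneracy $\delta(G)$. The algorithm $\mathsf{Degen\text{-}opt}(G,k)$ (defined in the context) computes a $k$-defective clique of $G$ in $\mathcal{O}(\delta(G)\cdot m)$ time.
   Context: All graphs are finite, simple, unweighted and undirected. A vertex set $C\subseteq V(G)$ is a $k$-defective clique if the subgraph of $G$ induced by $C$ has at most $k$ non-edges (unordered pairs of distinct non-adjacent vertices). A degeneracy ordering of $G$ is an ordering $(v_1,\dots,v_n)$ of $V(G)$ such that, for each $i$, $v_i$ has the smallest degree in the subgraph induced by $\{v_i,\dots,v_n\}$. The degeneracy $\delta(G)$ is the largest integer $d$ such that $G$ has a nonempty subgraph with all degrees at least $d$. A degeneracy ordering of a graph with $m$ edges can be computed in $\mathcal{O}(m)$ time by iteratively removing a vertex of smallest degree. Algorithm $\mathsf{Degen}(G,k)$: compute a degeneracy ordering of $G$ and return the longest suffix of it that is a $k$-defective clique. Algorithm $\mathsf{Degen\text{-}opt}(G,k)$: set $C\leftarrow\mathsf{Degen}(G,k)$; compute a degeneracy ordering of $G$; for each vertex $u\in V(G)$, let $N^+(u)$ be the set of neighbors of $u$ that come after $u$ in this ordering, let $g$ be the subgraph of $G$ induced by $N^+(u)$, set $C'\leftarrow\mathsf{Degen}(g,k)$, and if $|C'\cup\{u\}|>|C|$ set $C\leftarrow C'\cup\{u\}$. Return $C$.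
   Formalization: The bound O(δ(G)·m) fails for graphs with many isolated vertices (one edge plus n isolated vertices) or with no edges; proved instead is O(δ(G)·m + n + 1) for all graphs with n vertices, and O(δ(G)·m) for nonempty graphs without isolated vertices. *)

theory Defs
  imports Main
begin

section \<open>Finite simple graphs\<close>

type_synonym 'a ugraph = "'a set \<times> 'a set set"

abbreviation verts :: "'a ugraph \<Rightarrow> 'a set" where "verts G \<equiv> fst G"
abbreviation edges :: "'a ugraph \<Rightarrow> 'a set set" where "edges G \<equiv> snd G"

definition simple_graph :: "'a ugraph \<Rightarrow> bool" where
  "simple_graph G \<longleftrightarrow> finite (verts G) \<and> (\<forall>e \<in> edges G. e \<subseteq> verts G \<and> card e = 2)"

definition neighbors :: "'a ugraph \<Rightarrow> 'a \<Rightarrow> 'a set" where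
  "neighbors G v = {w. {v, w} \<in> edges G}"

definition deg :: "'a ugraph \<Rightarrow> 'a \<Rightarrow> nat" where
  "deg G v = card (neighbors G v)"

definition induced :: "'a ugraph \<Rightarrow> 'a set \<Rightarrow> 'a ugraph" where
  "induced G S = (S, {e \<in> edges G. e \<subseteq> S})"

definition subgraph :: "'a ugraph \<Rightarrow> 'a ugraph \<Rightarrow> bool" where
  "subgraph H G \<longleftrightarrow> simple_graph H \<and> verts H \<subseteq> verts G \<and> edges H \<subseteq> edges G"

definition non_edges :: "'a ugraph \<Rightarrow> 'a set set" where
  "non_edges G = {e. e \<subseteq> verts G \<and> card e = 2 \<and> e \<notin> edges G}"

definition defective_clique :: "'a ugraph \<Rightarrow> nat \<Rightarrow> 'a set \<Rightarrow> bool" where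
  "defective_clique G k C \<longleftrightarrow> C \<subseteq> verts G \<and> card (non_edges (induced G C)) \<le> k"

text \<open>The maximum exists for every simple graph with at least one vertex; for the graph without
  vertices the value is unspecified.\<close>

definition degeneracy :: "'a ugraph \<Rightarrow> nat" where
  "degeneracy G =
     Max {d. \<exists>H. subgraph H G \<and> verts H \<noteq> {} \<and> (\<forall>v \<in> verts H. d \<le> deg H v)}"

definition degeneracy_ordering :: "'a ugraph \<Rightarrow> 'a list \<Rightarrow> bool" where
  "degeneracy_ordering G vs \<longleftrightarrow>
     distinct vs \<and> set vs = verts G \<and>
     (\<forall>i < length vs. \<forall>w \<in> set (drop i vs).
        deg (induced G (set (drop i vs))) (vs ! i) \<le> deg (induced G (set (drop i vs))) w)"


section \<open>The algorithms as input-output relations\<close>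

text \<open>A graph has several degeneracy orderings and the algorithms do not say which one is computed,
  nor in which order the vertices are visited.  The relations below relate an input to every result
  that some sequence of such choices produces.\<close>

definition Degen :: "'a ugraph \<Rightarrow> nat \<Rightarrow> 'a set \<Rightarrow> bool" where
  "Degen G k C \<longleftrightarrow>
     (\<exists>vs i. degeneracy_ordering G vs \<and> i \<le> length vs \<and> C = set (drop i vs) \<and>
        defective_clique G k C \<and>
        (\<forall>j < i. \<not> defective_clique G k (set (drop j vs))))"

definition later_neighbors :: "'a ugraph \<Rightarrow> 'a list \<Rightarrow> 'a \<Rightarrow> 'a set" where
  "later_neighbors G vs u =
     {w \<in> neighbors G u. \<exists>i j. i < j \<and> j < length vs \<and> vs ! i = u \<and> vs ! j = w}"

text \<open>\<open>Degen_opt_loop G k vs us C D\<close>: running the loop body for the vertices of \<open>us\<close> in turn, starting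
  with the current solution \<open>C\<close>, can end with the current solution \<open>D\<close>.\<close>

inductive Degen_opt_loop ::
  "'a ugraph \<Rightarrow> nat \<Rightarrow> 'a list \<Rightarrow> 'a list \<Rightarrow> 'a set \<Rightarrow> 'a set \<Rightarrow> bool"
  for G k vs where
  loop_Nil: "Degen_opt_loop G k vs [] C C"
| loop_Cons: "\<lbrakk> Degen (induced G (later_neighbors G vs u)) k C';
     Degen_opt_loop G k vs us (if card (C' \<union> {u}) > card C then C' \<union> {u} else C) D \<rbrakk>
   \<Longrightarrow> Degen_opt_loop G k vs (u # us) C D"

definition Degen_opt :: "'a ugraph \<Rightarrow> nat \<Rightarrow> 'a set \<Rightarrow> bool" where
  "Degen_opt G k D \<longleftrightarrow>
     (\<exists>C vs us. Degen G k C \<and> degeneracy_ordering G vs \<and>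
        distinct us \<and> set us = verts G \<and> Degen_opt_loop G k vs us C D)"


section \<open>Random access machine programs and their running time\<close>

text \<open>A structured RAM with finitely many (per program) registers and arrays of natural numbers,
  named by strings.  The arithmetic is addition and truncated subtraction.  Each operation, each
  register or array access, each comparison and each control step takes one unit of time.\<close>

datatype aexp =
    Num nat
  | Reg string
  | Get string aexp
  | Add aexp aexp
  | Sub aexp aexp

datatype bexp =
    Less aexp aexp
  | Not bexp
  | And bexp bexp

datatype com =
    Skip
  | Assign string aexp
  | Store string aexp aexp
  | Seq com com
  | If bexp com com
  | While bexp com

text \<open>Contents of the registers and of the arrays.\<close>

type_synonym state = "(string \<Rightarrow> nat) \<times> (string \<Rightarrow> nat \<Rightarrow> nat)"

fun aval :: "aexp \<Rightarrow> state \<Rightarrow> nat" where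
  "aval (Num n) s = n"
| "aval (Reg x) s = fst s x"
| "aval (Get A a) s = snd s A (aval a s)"
| "aval (Add a b) s = aval a s + aval b s"
| "aval (Sub a b) s = aval a s - aval b s"

fun bval :: "bexp \<Rightarrow> state \<Rightarrow> bool" where
  "bval (Less a b) s = (aval a s < aval b s)"
| "bval (Not b) s = (\<not> bval b s)"
| "bval (And b c) s = (bval b s \<and> bval c s)"

fun acost :: "aexp \<Rightarrow> nat" where
  "acost (Num n) = 1"
| "acost (Reg x) = 1"
| "acost (Get A a) = 1 + acost a"
| "acost (Add a b) = 1 + acost a + acost b"
| "acost (Sub a b) = 1 + acost a + acost b"

fun bcost :: "bexp \<Rightarrow> nat" where
  "bcost (Less a b) = 1 + acost a + acost b"
| "bcost (Not b) = 1 + bcost b"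
| "bcost (And b c) = 1 + bcost b + bcost c"

text \<open>\<open>exec P s t s'\<close>: program \<open>P\<close>, started in \<open>s\<close>, halts in \<open>s'\<close> after \<open>t\<close> units of time.\<close>

inductive exec :: "com \<Rightarrow> state \<Rightarrow> nat \<Rightarrow> state \<Rightarrow> bool" where
  exec_Skip: "exec Skip s 1 s"
| exec_Assign:
    "exec (Assign x a) s (1 + acost a) ((fst s)(x := aval a s), snd s)"
| exec_Store:
    "exec (Store A i a) s (1 + acost i + acost a)
       (fst s, (snd s)(A := (snd s A)(aval i s := aval a s)))"
| exec_Seq:
    "\<lbrakk> exec P s t s'; exec Q s' u s'' \<rbrakk> \<Longrightarrow> exec (Seq P Q) s (t + u) s''"
| exec_IfTrue:
    "\<lbrakk> bval b s; exec P s t s' \<rbrakk> \<Longrightarrow> exec (If b P Q) s (1 + bcost b + t) s'"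
| exec_IfFalse:
    "\<lbrakk> \<not> bval b s; exec Q s t s' \<rbrakk> \<Longrightarrow> exec (If b P Q) s (1 + bcost b + t) s'"
| exec_WhileFalse:
    "\<not> bval b s \<Longrightarrow> exec (While b P) s (1 + bcost b) s"
| exec_WhileTrue:
    "\<lbrakk> bval b s; exec P s t s'; exec (While b P) s' u s'' \<rbrakk>
     \<Longrightarrow> exec (While b P) s (1 + bcost b + t + u) s''"

lemma exec_deterministic:
  "exec P s t s' \<Longrightarrow> exec P s u s'' \<Longrightarrow> u = t \<and> s'' = s'"
proof (induction arbitrary: u s'' rule: exec.induct)
  case exec_Seq
  from exec_Seq.prems show ?case by cases (blast dest: exec_Seq.IH)
next
  case exec_IfTrue
  from exec_IfTrue.prems exec_IfTrue.hyps(1) show ?case by cases (blast dest: exec_IfTrue.IH)+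
next
  case exec_IfFalse
  from exec_IfFalse.prems exec_IfFalse.hyps(1) show ?case by cases (blast dest: exec_IfFalse.IH)+
next
  case exec_WhileFalse
  from exec_WhileFalse.prems exec_WhileFalse.hyps show ?case by cases blast+
next
  case exec_WhileTrue
  from exec_WhileTrue.prems exec_WhileTrue.hyps(1) show ?case
    by cases (blast dest: exec_WhileTrue.IH)+
qed (erule exec.cases; simp)+


section \<open>Input and output of programs\<close>

text \<open>The vertices are numbered from \<open>0\<close>, and the graph is given by its adjacency lists, the entries
  of which come in any order.\<close>

definition adjacency_lists :: "nat ugraph \<Rightarrow> nat list list \<Rightarrow> bool" where
  "adjacency_lists G ns \<longleftrightarrow>
     verts G = {..<length ns} \<and>
     (\<forall>v < length ns. distinct (ns ! v) \<and> set (ns ! v) = neighbors G v)"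

definition array_of :: "nat list \<Rightarrow> nat \<Rightarrow> nat" where
  "array_of xs i = (if i < length xs then xs ! i else 0)"

text \<open>The adjacency lists are stored one after the other in the array \<open>adj\<close>; the list of vertex \<open>v\<close>
  occupies the positions from \<open>off v\<close> up to, but not including, \<open>off (v + 1)\<close>.  All memory that does
  not hold input is zero.\<close>

definition input_state :: "nat list list \<Rightarrow> nat \<Rightarrow> state" where
  "input_state ns k =
     ((\<lambda>_. 0)(''n'' := length ns, ''k'' := k),
      (\<lambda>_ _. 0)(
        ''off'' := array_of (map (\<lambda>v. length (concat (take v ns))) [0..<Suc (length ns)]),
        ''adj'' := array_of (concat ns)))"

definition output_list :: "state \<Rightarrow> nat list" where
  "output_list s = map (snd s ''out'') [0..<fst s ''size'']"

end

theory Submission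
  imports Defs
begin

text \<open>A vertex has at most \<open>\<delta>(G)\<close> later neighbors, because its degree in its suffix is the minimum
  degree of that suffix. Hence the adjacency lists of the subgraph \<open>g\<close> induced by \<open>N\<^sup>+(u)\<close> can be built
  by scanning only the lists of later neighbors of the vertices in \<open>N\<^sup>+(u)\<close>, and a linear-time \<open>Degen\<close>
  on \<open>g\<close> takes time \<open>O(|N\<^sup>+(u)|\<^sup>2)\<close>; both are \<open>O(\<delta>(G) |N\<^sup>+(u)| + 1)\<close>, and the sizes \<open>|N\<^sup>+(u)|\<close> sum to
  at most the number of edges. \<open>Degen\<close> itself runs in linear time: the vertices are kept in
  buckets by degree, and since the minimum degree \<open>d\<close> is at most the degree of the vertex removed, each
  round can afford to search the buckets from \<open>0\<close> up to \<open>d\<close>. The degrees recorded at the removals give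
  the number of non-edges of every suffix.\<close>

section \<open>Graphs\<close>

text \<open>The relations admit every sequence of choices, so the program has to realise only one:
  the ordering found for the initial solution also serves as the ordering of the loop, and the
  vertices are visited in numerical order. The main obstacle is reuse of memory.
  \<open>degen\<close> runs once per vertex on arrays left dirty by earlier runs, and clearing
  anything of size |V(G)| each time would ruin the bound. So only cells belonging to the current
  subgraph are reset, and membership in it is decided by marks that grow with \<open>u\<close>. The
  linear time of \<open>degen\<close> is amortised: every bucket node carries 40 units, more than
  the iteration that pops it costs, hence bounds of the form \<open>t + 40 * num_nodes n B\<close>.
  The constants are generous roundings of the unit costs of straight-line code. For an edgeless
  graph \<delta>(G) m is 0 although each vertex costs time. The general bound therefore has the
  additional terms n + 1; they are absorbed for a nonempty graph without isolated vertices, where n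
  \<le> 2m and \<delta>(G) \<ge> 1.\<close>

lemma neighbors_sym: "w \<in> neighbors G v \<longleftrightarrow> v \<in> neighbors G w"
  by (simp add: neighbors_def insert_commute)

lemma neighbors_subset: "simple_graph G \<Longrightarrow> neighbors G v \<subseteq> verts G"
  by (auto simp: neighbors_def simple_graph_def)

lemma neighbors_irrefl: "simple_graph G \<Longrightarrow> v \<notin> neighbors G v"
  by (auto simp: neighbors_def simple_graph_def)

lemma finite_neighbors: "simple_graph G \<Longrightarrow> finite (neighbors G v)"
  by (meson finite_subset neighbors_subset simple_graph_def)

lemma finite_edges: "simple_graph G \<Longrightarrow> finite (edges G)"
  by (rule finite_subset[of _ "Pow (verts G)"]) (auto simp: simple_graph_def)

lemma verts_induced [simp]: "verts (induced G S) = S"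
  by (simp add: induced_def)

lemma induced_induced: "T \<subseteq> S \<Longrightarrow> induced (induced G S) T = induced G T"
  by (auto simp: induced_def)

lemma induced_verts: "simple_graph G \<Longrightarrow> induced G (verts G) = G"
  by (auto simp: induced_def simple_graph_def intro!: prod_eqI)

lemma simple_graph_induced: "simple_graph G \<Longrightarrow> S \<subseteq> verts G \<Longrightarrow> simple_graph (induced G S)"
  by (auto simp: induced_def simple_graph_def intro: finite_subset)

lemma neighbors_induced: "v \<in> S \<Longrightarrow> neighbors (induced G S) v = neighbors G v \<inter> S"
  by (auto simp: induced_def neighbors_def)

lemma deg_less_card:
  assumes "simple_graph G" "v \<in> verts G"
  shows "deg G v < card (verts G)"
proof -
  have "neighbors G v \<subset> verts G"
    using neighbors_subset[OF assms(1)] neighbors_irrefl[OF assms(1), of v] assms(2) by blast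
  then show ?thesis
    using assms(1) by (auto simp: deg_def simple_graph_def psubset_card_mono)
qed

lemma deg_induced_remove:
  assumes "simple_graph G" "w \<in> S" "w \<noteq> v" "v \<in> S"
  shows "deg (induced G (S - {v})) w =
    deg (induced G S) w - (if w \<in> neighbors G v then 1 else 0)"
proof -
  have *: "neighbors G w \<inter> (S - {v}) = (neighbors G w \<inter> S) - {v}"
    by blast
  show ?thesis
    using assms finite_neighbors[OF assms(1), of w] neighbors_sym[of w G v]
    by (auto simp: deg_def neighbors_induced * card_Diff_singleton_if)
qed

section \<open>Counting non-edges\<close>

lemma finite_non_edges: "finite (verts G) \<Longrightarrow> finite (non_edges G)"
  by (rule finite_subset[of _ "Pow (verts G)"]) (auto simp: non_edges_def)

lemma card_non_edges_mono:
  assumes "T \<subseteq> S" "finite S"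
  shows "card (non_edges (induced G T)) \<le> card (non_edges (induced G S))"
  by (rule card_mono) (use assms in \<open>auto simp: finite_non_edges, auto simp: non_edges_def induced_def\<close>)

text \<open>A non-edge of the larger set lies in \<open>S\<close> or joins \<open>v\<close> to a
  vertex of \<open>S\<close> not adjacent to it. The additive form avoids truncated subtraction.
  This is the recurrence by which the program counts the non-edges of suffixes.\<close>

lemma card_non_edges_insert:
  assumes "simple_graph G" "finite S" "v \<notin> S"
  shows "card (non_edges (induced G (insert v S))) + deg (induced G (insert v S)) v =
    card (non_edges (induced G S)) + card S"
proof -
  let ?N = "neighbors G v \<inter> S"
  have nb: "neighbors (induced G (insert v S)) v = ?N"
    using neighbors_irrefl[OF assms(1), of v] by (auto simp: neighbors_induced)
  have split: "non_edges (induced G (insert v S)) =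
      non_edges (induced G S) \<union> (\<lambda>w. {v, w}) ` (S - ?N)" (is "?L = ?A \<union> ?B")
  proof (intro equalityI subsetI)
    fix e assume e: "e \<in> ?L"
    show "e \<in> ?A \<union> ?B"
    proof (cases "v \<in> e")
      case True
      have "card e = 2" using e by (simp add: non_edges_def)
      then obtain w where "e = {v, w}" "w \<noteq> v"
        using True by (auto simp: card_2_iff)
      then show ?thesis
        using e by (auto simp: non_edges_def induced_def neighbors_def)
    next
      case False
      then show ?thesis using e by (auto simp: non_edges_def induced_def)
    qed
  next
    fix e assume "e \<in> ?A \<union> ?B"
    then show "e \<in> ?L"
      using assms(3)
      by (auto simp: non_edges_def induced_def neighbors_def insert_commute card_insert_if)
  qed
  have "inj_on (\<lambda>w. {v, w}) (S - ?N)"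
    by (auto simp: inj_on_def doubleton_eq_iff)
  then have cB: "card ?B = card S - card ?N"
    using assms(2) by (simp add: card_image card_Diff_subset)
  have "?A \<inter> ?B = {}"
    using assms(3) by (auto simp: non_edges_def)
  then have "card ?L = card ?A + (card S - card ?N)"
    unfolding split using assms(2) by (subst card_Un_disjoint) (auto simp: finite_non_edges cB)
  moreover have "card ?N \<le> card S"
    using assms(2) by (simp add: card_mono)
  ultimately show ?thesis
    by (simp add: deg_def nb)
qed

lemma defective_clique_subset:
  assumes "defective_clique G k S" "T \<subseteq> S" "finite S"
  shows "defective_clique G k T"
  using assms card_non_edges_mono[OF assms(2,3), of G] by (auto simp: defective_clique_def)

section \<open>Later neighbors, degeneracy and the number of edges\<close>

lemma set_later_neighbors:
  assumes "distinct vs" "i < length vs"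
  shows "later_neighbors G vs (vs ! i) = neighbors G (vs ! i) \<inter> set (drop (Suc i) vs)"
proof (intro equalityI subsetI)
  fix w assume "w \<in> later_neighbors G vs (vs ! i)"
  then obtain j where "w \<in> neighbors G (vs ! i)" "i < j" "j < length vs" "vs ! j = w"
    using assms unfolding later_neighbors_def mem_Collect_eq
    by (metis (no_types, opaque_lifting) less_trans nth_eq_iff_index_eq)
  then show "w \<in> neighbors G (vs ! i) \<inter> set (drop (Suc i) vs)"
    by (auto simp: in_set_conv_nth intro!: exI[of _ "j - Suc i"])
next
  fix w assume w: "w \<in> neighbors G (vs ! i) \<inter> set (drop (Suc i) vs)"
  then obtain j where "j < length vs - Suc i" "w = drop (Suc i) vs ! j"
    by (metis IntD2 in_set_conv_nth length_drop)
  then have "Suc i + j < length vs" "w = vs ! (Suc i + j)"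
    using assms by auto
  then show "w \<in> later_neighbors G vs (vs ! i)"
    using w assms unfolding later_neighbors_def mem_Collect_eq
    by (metis IntD1 add_Suc less_add_Suc1)
qed

text \<open>As \<open>degeneracy\<close> is a \<open>Max\<close>, the set of candidates must be
  finite before a witness \<open>H\<close> can bound it from below. Each candidate is less than the
  number of vertices of its own witness.\<close>

lemma degeneracy_ge:
  assumes "simple_graph G" "subgraph H G" "verts H \<noteq> {}" "\<forall>v \<in> verts H. d \<le> deg H v"
  shows "d \<le> degeneracy G"
proof -
  let ?D = "{d. \<exists>H. subgraph H G \<and> verts H \<noteq> {} \<and> (\<forall>v \<in> verts H. d \<le> deg H v)}"
  have "d \<le> card (verts G)" if d: "d \<in> ?D" for d
  proof -
    obtain H v where H: "subgraph H G" "v \<in> verts H" "d \<le> deg H v"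
      using d by blast
    have "deg H v < card (verts H)"
      using H by (intro deg_less_card) (auto simp: subgraph_def)
    also have "\<dots> \<le> card (verts G)"
      using H assms(1) by (intro card_mono) (auto simp: subgraph_def simple_graph_def)
    finally show ?thesis using H by simp
  qed
  then have "finite ?D"
    by (meson finite_nat_set_iff_bounded_le)
  then show ?thesis
    unfolding degeneracy_def by (rule Max_ge) (use assms in blast)
qed

lemma card_later_neighbors_le:
  assumes "simple_graph G" "degeneracy_ordering G vs" "u \<in> verts G"
  shows "card (later_neighbors G vs u) \<le> degeneracy G"
proof -
  have vs: "distinct vs" "set vs = verts G"
    using assms(2) by (auto simp: degeneracy_ordering_def)
  obtain i where i: "i < length vs" "u = vs ! i"
    using assms(3) vs by (metis in_set_conv_nth)
  let ?S = "set (drop i vs)"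
  have S: "?S = insert u (set (drop (Suc i) vs))"
    using i by (simp add: Cons_nth_drop_Suc[symmetric])
  have sub: "?S \<subseteq> verts G"
    using set_drop_subset[of i vs] vs by simp
  have "later_neighbors G vs u = neighbors (induced G ?S) u"
    using set_later_neighbors[OF vs(1) i(1)] i neighbors_irrefl[OF assms(1), of u]
    by (auto simp: S neighbors_induced)
  then have "card (later_neighbors G vs u) = deg (induced G ?S) u"
    by (simp add: deg_def)
  also have "\<dots> \<le> degeneracy G"
  proof (rule degeneracy_ge[OF assms(1)])
    show "subgraph (induced G ?S) G"
      using simple_graph_induced[OF assms(1) sub] sub by (auto simp: subgraph_def induced_def)
    show "verts (induced G ?S) \<noteq> {}"
      using S by auto
    show "\<forall>w\<in>verts (induced G ?S). deg (induced G ?S) u \<le> deg (induced G ?S) w"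
      using assms(2) i unfolding degeneracy_ordering_def by simp
  qed
  finally show ?thesis .
qed

text \<open>A single edge is a subgraph with both degrees 1. This is what absorbs terms linear in m
  into \<delta>(G) m.\<close>

lemma degeneracy_pos:
  assumes "simple_graph G" "edges G \<noteq> {}"
  shows "1 \<le> degeneracy G"
proof -
  obtain e where e: "e \<in> edges G"
    using assms(2) by blast
  then obtain a b where ab: "e = {a, b}" "a \<noteq> b"
    using assms(1) by (metis card_2_iff simple_graph_def)
  let ?H = "({a, b}, {{a, b}})"
  have "neighbors ?H a = {b}" "neighbors ?H b = {a}"
    unfolding neighbors_def snd_conv by (simp_all add: doubleton_eq_iff ab(2) ab(2)[symmetric])
  then have "\<forall>v\<in>verts ?H. 1 \<le> deg ?H v"
    by (simp add: deg_def)
  moreover have "subgraph ?H G"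
    using e ab assms(1) by (auto simp: subgraph_def simple_graph_def)
  ultimately show ?thesis
    by (intro degeneracy_ge[OF assms(1), of ?H]) auto
qed

text \<open>Ordered pairs of adjacent vertices are grouped by the edge they span, and at most two
  pairs span the same edge.\<close>

lemma sum_deg_le:
  assumes "simple_graph G"
  shows "(\<Sum>v\<in>verts G. deg G v) \<le> 2 * card (edges G)"
proof -
  have fin: "finite (verts G)"
    using assms by (simp add: simple_graph_def)
  let ?P = "\<lambda>e. {p. {fst p, snd p} = e}"
  have P: "finite (?P e) \<and> card (?P e) \<le> 2" if "e \<in> edges G" for e
  proof -
    obtain a b where "e = {a, b}"
      using assms \<open>e \<in> edges G\<close> by (metis card_2_iff simple_graph_def)
    then have "?P e \<subseteq> {(a, b), (b, a)}"
      by (auto simp: doubleton_eq_iff)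
    moreover have "card {(a, b), (b, a)} \<le> 2"
      by (rule card_insert_le_m1) simp_all
    ultimately show ?thesis
      using card_mono[of "{(a, b), (b, a)}" "?P e"] finite_subset[of "?P e" "{(a, b), (b, a)}"]
      by simp
  qed
  have "(\<Sum>v\<in>verts G. deg G v) = card (Sigma (verts G) (neighbors G))"
    using fin by (subst card_SigmaI) (auto simp: finite_neighbors[OF assms] deg_def)
  also have "\<dots> \<le> card (\<Union>e\<in>edges G. ?P e)"
    using P finite_edges[OF assms] by (intro card_mono) (auto simp: neighbors_def)
  also have "\<dots> \<le> (\<Sum>e\<in>edges G. card (?P e))"
    by (rule card_UN_le[OF finite_edges[OF assms]])
  also have "\<dots> \<le> (\<Sum>e\<in>edges G. 2)"
    using P by (intro sum_mono) auto
  finally show ?thesis by simp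
qed

section \<open>Every result of the algorithms is a k-defective clique\<close>

lemma Degen_imp_defective_clique: "Degen G k C \<Longrightarrow> defective_clique G k C"
  by (auto simp: Degen_def)

text \<open>\<open>u\<close> is adjacent to all of \<open>C\<close>, so its degree in the enlarged
  set is \<open>card C\<close> and the count of non-edges stays the same.\<close>

lemma defective_clique_insert_later:
  assumes "simple_graph G" "u \<in> verts G"
    and "defective_clique (induced G (later_neighbors G vs u)) k C"
  shows "defective_clique G k (C \<union> {u})"
proof -
  have C: "C \<subseteq> neighbors G u" "C \<subseteq> later_neighbors G vs u"
    using assms(3) by (auto simp: defective_clique_def later_neighbors_def)
  have fC: "finite C"
    using C(1) finite_neighbors[OF assms(1)] by (rule finite_subset)
  have "u \<notin> C"
    using C(1) neighbors_irrefl[OF assms(1)] by blast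
  then have "neighbors (induced G (insert u C)) u = C"
    using C(1) neighbors_irrefl[OF assms(1), of u] by (auto simp: neighbors_induced)
  then have "card (non_edges (induced G (insert u C))) = card (non_edges (induced G C))"
    using card_non_edges_insert[OF assms(1) fC \<open>u \<notin> C\<close>] by (simp add: deg_def)
  then show ?thesis
    using assms C neighbors_subset[OF assms(1), of u]
    by (auto simp: defective_clique_def induced_induced)
qed

lemma Degen_opt_loop_defective_clique:
  assumes "simple_graph G" "Degen_opt_loop G k vs us C D" "set us \<subseteq> verts G"
    "defective_clique G k C"
  shows "defective_clique G k D"
  using assms(2-4)
proof (induction rule: Degen_opt_loop.induct)
  case (loop_Cons u C' us C D)
  then show ?case
    using defective_clique_insert_later[OF assms(1)] Degen_imp_defective_clique
    by (metis insert_subset list.simps(15))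
qed

lemma Degen_opt_defective_clique:
  "simple_graph G \<Longrightarrow> Degen_opt G k C \<Longrightarrow> defective_clique G k C"
  using Degen_opt_loop_defective_clique Degen_imp_defective_clique
  unfolding Degen_opt_def by blast

text \<open>The inductive rules consume the vertex list from the front, whereas a loop invariant
  speaks of a processed prefix that grows at its end.\<close>

lemma Degen_opt_loop_snoc:
  assumes "Degen_opt_loop G k vs us C D" "Degen (induced G (later_neighbors G vs u)) k C'"
  shows "Degen_opt_loop G k vs (us @ [u]) C (if card (C' \<union> {u}) > card D then C' \<union> {u} else D)"
  using assms
proof (induction rule: Degen_opt_loop.induct)
  case (loop_Nil C)
  show ?case
    using Degen_opt_loop.loop_Cons[OF loop_Nil Degen_opt_loop.loop_Nil] by simp
next
  case loop_Cons
  then show ?case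
    by (metis Degen_opt_loop.loop_Cons append_Cons)
qed

section \<open>Peeling off vertices of smallest degree\<close>

text \<open>An unfinished degeneracy ordering with the degrees \<open>rs\<close> recorded at the
  removals. It is phrased by the vertices that remain after a prefix, because the suffixes used in
  \<open>degeneracy_ordering\<close> are unknown until everything has been removed.\<close>

definition peeling :: "'a ugraph \<Rightarrow> 'a list \<Rightarrow> nat list \<Rightarrow> bool" where
  "peeling G os rs \<longleftrightarrow> distinct os \<and> set os \<subseteq> verts G \<and> length rs = length os \<and>
     (\<forall>j < length os. rs ! j = deg (induced G (verts G - set (take j os))) (os ! j) \<and>
        (\<forall>w \<in> verts G - set (take j os).
           rs ! j \<le> deg (induced G (verts G - set (take j os))) w))"

lemma peeling_Nil: "peeling G [] []"
  by (simp add: peeling_def)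

lemma peeling_snoc:
  assumes "peeling G os rs" "v \<in> verts G - set os"
    "d = deg (induced G (verts G - set os)) v"
    "\<forall>w \<in> verts G - set os. d \<le> deg (induced G (verts G - set os)) w"
  shows "peeling G (os @ [v]) (rs @ [d])"
  using assms by (auto simp: peeling_def nth_append less_Suc_eq)

lemma peeling_drop:
  assumes "peeling G os rs" "set os = verts G" "j \<le> length os"
  shows "verts G - set (take j os) = set (drop j os)"
proof -
  have "set os = set (take j os) \<union> set (drop j os)"
    by (metis append_take_drop_id set_append)
  moreover have "set (take j os) \<inter> set (drop j os) = {}"
    using assms(1) by (simp add: peeling_def set_take_disj_set_drop_if_distinct)
  ultimately show ?thesis
    using assms(2) by blast
qed

lemma peeling_degeneracy_ordering:
  assumes "peeling G os rs" "set os = verts G"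
  shows "degeneracy_ordering G os"
  using assms peeling_drop[OF assms] unfolding peeling_def degeneracy_ordering_def
  by (metis order_less_imp_le)

text \<open>Of the \<open>length os - Suc b\<close> vertices after \<open>os ! b\<close>, exactly
  \<open>rs ! b\<close> are adjacent to it; each of the others contributes one non-edge.\<close>

lemma peeling_non_edges_Suc:
  assumes "simple_graph G" "peeling G os rs" "set os = verts G" "b < length os"
  shows "card (non_edges (induced G (set (drop b os)))) + rs ! b =
    card (non_edges (induced G (set (drop (Suc b) os)))) + (length os - Suc b)"
proof -
  have d: "distinct (drop b os)"
    using assms(2) by (simp add: peeling_def)
  have eq: "drop b os = os ! b # drop (Suc b) os"
    using assms(4) by (simp add: Cons_nth_drop_Suc)
  have "rs ! b = deg (induced G (set (drop b os))) (os ! b)"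
    using assms peeling_drop[OF assms(2,3), of b] by (auto simp: peeling_def)
  then show ?thesis
    using card_non_edges_insert[OF assms(1), of "set (drop (Suc b) os)" "os ! b"] d
    by (auto simp: eq distinct_card)
qed

text \<open>Being a k-defective clique is inherited by subsets, and every longer suffix contains the
  one from \<open>b - 1\<close> on. So failure of that single suffix excludes all longer ones, which
  justifies stopping at the first failure.\<close>

lemma Degen_drop:
  assumes "simple_graph G" "degeneracy_ordering G os" "b \<le> length os"
    "card (non_edges (induced G (set (drop b os)))) \<le> k"
    "b \<noteq> 0 \<Longrightarrow> k < card (non_edges (induced G (set (drop (b - 1) os))))"
  shows "Degen G k (set (drop b os))"
proof -
  have sub: "set (drop j os) \<subseteq> verts G" for j
    using assms(2) set_drop_subset[of j os] by (simp add: degeneracy_ordering_def)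
  have "\<not> defective_clique G k (set (drop j os))" if "j < b" for j
    using defective_clique_subset[of G k "set (drop j os)" "set (drop (b - 1) os)"]
      assms(5) that set_drop_subset_set_drop[of j "b - 1" os]
    by (auto simp: defective_clique_def)
  then show ?thesis
    using assms sub unfolding Degen_def defective_clique_def by blast
qed

section \<open>Reasoning about programs\<close>

text \<open>Total correctness with the running time handed to the postcondition. Execution is
  deterministic, so the run that exists is the only one.\<close>

definition wp :: "com \<Rightarrow> (nat \<Rightarrow> state \<Rightarrow> bool) \<Rightarrow> state \<Rightarrow> bool" where
  "wp P Q s \<longleftrightarrow> (\<exists>t s'. exec P s t s' \<and> Q t s')"

inductive_cases SkipE: "exec Skip s t s'"
inductive_cases AssignE: "exec (Assign x a) s t s'"
inductive_cases StoreE: "exec (Store A i a) s t s'"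
inductive_cases SeqE: "exec (Seq P Q) s t s'"

lemma wp_Skip [simp]: "wp Skip Q s \<longleftrightarrow> Q 1 s"
  unfolding wp_def by (metis exec_Skip SkipE)

lemma wp_Assign [simp]:
  "wp (Assign x a) Q s \<longleftrightarrow> Q (1 + acost a) ((fst s)(x := aval a s), snd s)"
  unfolding wp_def by (metis exec_Assign AssignE)

lemma wp_Store [simp]:
  "wp (Store A i a) Q s \<longleftrightarrow>
     Q (1 + acost i + acost a) (fst s, (snd s)(A := (snd s A)(aval i s := aval a s)))"
  unfolding wp_def by (metis exec_Store StoreE)

lemma wp_Seq [simp]: "wp (Seq P R) Q s \<longleftrightarrow> wp P (\<lambda>t s'. wp R (\<lambda>u s''. Q (t + u) s'') s') s"
  unfolding wp_def by (metis exec_Seq SeqE)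

lemma wp_If [simp]:
  "wp (If b P R) Q s \<longleftrightarrow> wp (if bval b s then P else R) (\<lambda>t s'. Q (1 + bcost b + t) s') s"
proof
  assume "wp (If b P R) Q s"
  then obtain t s' where "exec (If b P R) s t s'" "Q t s'"
    by (auto simp: wp_def)
  then show "wp (if bval b s then P else R) (\<lambda>t s'. Q (1 + bcost b + t) s') s"
    by (cases rule: exec.cases) (auto simp: wp_def simp del: split_paired_Ex)
next
  assume "wp (if bval b s then P else R) (\<lambda>t s'. Q (1 + bcost b + t) s') s"
  then obtain t s' where "exec (if bval b s then P else R) s t s'" "Q (1 + bcost b + t) s'"
    by (auto simp: wp_def)
  then show "wp (If b P R) Q s"
    using exec_IfTrue[of b s P t s' R] exec_IfFalse[of b s R t s' P]
    unfolding wp_def by (cases "bval b s") (simp only: if_True if_False simp_thms, blast)+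
qed

section \<open>Frame conditions and loop rules\<close>

fun mod_regs :: "com \<Rightarrow> string set" where
  "mod_regs Skip = {}"
| "mod_regs (Assign x a) = {x}"
| "mod_regs (Store A i a) = {}"
| "mod_regs (Seq P Q) = mod_regs P \<union> mod_regs Q"
| "mod_regs (If b P Q) = mod_regs P \<union> mod_regs Q"
| "mod_regs (While b P) = mod_regs P"

fun mod_arrays :: "com \<Rightarrow> string set" where
  "mod_arrays Skip = {}"
| "mod_arrays (Assign x a) = {}"
| "mod_arrays (Store A i a) = {A}"
| "mod_arrays (Seq P Q) = mod_arrays P \<union> mod_arrays Q"
| "mod_arrays (If b P Q) = mod_arrays P \<union> mod_arrays Q"
| "mod_arrays (While b P) = mod_arrays P"

lemma exec_frame:
  assumes "exec P s t s'"
  shows "x \<notin> mod_regs P \<Longrightarrow> fst s' x = fst s x" "A \<notin> mod_arrays P \<Longrightarrow> snd s' A = snd s A"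
  using assms by (induction rule: exec.induct) auto

text \<open>The rule of consequence extended by equations for everything the program never assigns.
  Specifications can thus be confined to what changes, and the rest follows from the computed sets
  \<open>mod_regs\<close> and \<open>mod_arrays\<close>.\<close>

lemma wp_conseq_frame:
  assumes "wp P Q s"
    and "\<And>t s'. Q t s' \<Longrightarrow> (\<And>x. x \<notin> mod_regs P \<Longrightarrow> fst s' x = fst s x) \<Longrightarrow>
      (\<And>A. A \<notin> mod_arrays P \<Longrightarrow> snd s' A = snd s A) \<Longrightarrow> R t s'"
  shows "wp P R s"
  using assms exec_frame unfolding wp_def by metis

text \<open>The time spent so far is an argument of the invariant; as every iteration takes time, a
  bound on it also yields termination.\<close>

lemma wp_While:
  assumes "I 0 s"
    and step: "\<And>t s. I t s \<Longrightarrow> bval b s \<Longrightarrow> wp P (\<lambda>u s'. I (1 + bcost b + t + u) s') s"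
    and bound: "\<And>t s. I t s \<Longrightarrow> t \<le> M"
    and post: "\<And>t s. I t s \<Longrightarrow> \<not> bval b s \<Longrightarrow> Q (1 + bcost b + t) s"
  shows "wp (While b P) Q s"
proof -
  have "\<exists>u s'. exec (While b P) s u s' \<and> Q (t + u) s'" if "I t s" for t s
    using that
  proof (induction "M - t" arbitrary: t s rule: less_induct)
    case less
    show ?case
    proof (cases "bval b s")
      case True
      then obtain u s' where u: "exec P s u s'" "I (1 + bcost b + t + u) s'"
        using step[OF less.prems] by (auto simp: wp_def)
      then have "M - (1 + bcost b + t + u) < M - t"
        using bound[OF u(2)] by linarith
      then obtain w s'' where "exec (While b P) s' w s''" "Q (1 + bcost b + t + u + w) s''"
        using less.hyps u(2) by blast
      then show ?thesis
        using exec_WhileTrue[OF True u(1)] by (metis add.assoc add.commute)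
    next
      case False
      then show ?thesis
        using exec_WhileFalse[OF False, of P] post[OF less.prems]
        by (metis add.commute)
    qed
  qed
  from this[OF assms(1)] show ?thesis
    by (simp add: wp_def)
qed

definition For :: "string \<Rightarrow> aexp \<Rightarrow> com \<Rightarrow> com" where
  "For x e P = Seq (Assign x (Num 0))
     (While (Less (Reg x) e) (Seq P (Assign x (Add (Reg x) (Num 1)))))"

lemma mod_For [simp]:
  "mod_regs (For x e P) = insert x (mod_regs P)" "mod_arrays (For x e P) = mod_arrays P"
  by (auto simp: For_def)

text \<open>\<open>e\<close> is evaluated anew in every round, so the invariant has to fix its value
  \<open>N\<close>. A test costs \<open>3 + acost e\<close> and the increment 4, which makes
  \<open>7 + acost e\<close> per round; the initialisation costs 2, which with the last test makes
  \<open>5 + acost e\<close>. The bound \<open>M\<close> provides termination through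
  \<open>wp_While\<close>.\<close>

lemma wp_For:
  assumes init: "I 0 0 ((fst s)(x := 0), snd s)"
    and bnd: "\<And>i t s. I i t s \<Longrightarrow> aval e s = N"
    and step: "\<And>i t s. I i t s \<Longrightarrow> fst s x = i \<Longrightarrow> i < N \<Longrightarrow>
      wp P (\<lambda>u s'. I (Suc i) (7 + acost e + t + u) ((fst s')(x := Suc i), snd s')) s"
    and bound: "\<And>i t s. I i t s \<Longrightarrow> i \<le> N \<Longrightarrow> t \<le> M"
    and mod: "x \<notin> mod_regs P"
    and post: "\<And>t s. I N t s \<Longrightarrow> fst s x = N \<Longrightarrow> Q (5 + acost e + t) s"
  shows "wp (For x e P) Q s"
  unfolding For_def wp_Seq wp_Assign
proof (rule wp_While[where I = "\<lambda>t s. I (fst s x) t s \<and> fst s x \<le> N" and M = M])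
  fix t s assume *: "I (fst s x) t s \<and> fst s x \<le> N" and b: "bval (Less (Reg x) e) s"
  have lt: "fst s x < N"
    using b * bnd[of "fst s x" t s] by simp
  show "wp (Seq P (Assign x (Add (Reg x) (Num 1))))
      (\<lambda>u s'. I (fst s' x) (1 + bcost (Less (Reg x) e) + t + u) s' \<and> fst s' x \<le> N) s"
    unfolding wp_Seq
    using step[OF conjunct1[OF *] refl lt]
  proof (rule wp_conseq_frame)
    fix u s'
    assume I: "I (Suc (fst s x)) (7 + acost e + t + u) ((fst s')(x := Suc (fst s x)), snd s')"
      and fr: "\<And>y. y \<notin> mod_regs P \<Longrightarrow> fst s' y = fst s y"
    have "1 + bcost (Less (Reg x) e) + t + (u + (1 + acost (Add (Reg x) (Num 1)))) =
        7 + acost e + t + u"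
      by simp
    then show "wp (Assign x (Add (Reg x) (Num 1)))
        (\<lambda>w s''. I (fst s'' x) (1 + bcost (Less (Reg x) e) + t + (u + w)) s'' \<and> fst s'' x \<le> N) s'"
      unfolding wp_Assign using I fr[OF mod] lt by (simp add: eval_nat_numeral)
  qed
next
  fix t s assume *: "I (fst s x) t s \<and> fst s x \<le> N" and b: "\<not> bval (Less (Reg x) e) s"
  then have "fst s x = N"
    using bnd[of "fst s x" t s] by auto
  then show "Q (1 + acost (Num 0) + (1 + bcost (Less (Reg x) e) + t)) s"
    using post[of t s] * by (simp add: eval_nat_numeral)
qed (use init bound in auto)

section \<open>A linear-time program for \<open>Degen\<close>\<close>

notation Seq (infixr \<open>;;\<close> 60)

text \<open>A bucket is a linked list of nodes; node \<open>p\<close> holds the vertex \<open>X[p]\<close>, its successor is \<open>N[p]\<close>,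
  and \<open>0\<close> is the null pointer. Nodes are never moved: when the degree of a vertex drops, a new node
  is pushed, and a node is recognized as outdated only when it is popped.\<close>

fun chain :: "(nat \<Rightarrow> nat) \<Rightarrow> nat \<Rightarrow> nat list \<Rightarrow> bool" where
  "chain nx p [] \<longleftrightarrow> p = 0"
| "chain nx p (q # qs) \<longleftrightarrow> p = q \<and> 0 < q \<and> chain nx (nx q) qs"

lemma chain_cong: "(\<And>q. q \<in> set qs \<Longrightarrow> nx q = nx' q) \<Longrightarrow> chain nx p qs = chain nx' p qs"
  by (induction qs arbitrary: p) auto

text \<open>\<open>U\<close> are the remaining vertices, \<open>W\<close> all of them, and
  \<open>B\<close> is a ghost variable listing the nodes of each chain. Two things matter: nodes in
  use are at most \<open>e\<close>, so \<open>Suc e\<close> is fresh, and each remaining vertex has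
  some node in the bucket of its current degree. Other nodes, of removed vertices or for former
  degrees, may occur anywhere.\<close>

definition buckets ::
  "nat \<Rightarrow> nat set \<Rightarrow> nat set \<Rightarrow> (nat \<Rightarrow> nat) \<Rightarrow> (nat \<Rightarrow> nat) \<Rightarrow> (nat \<Rightarrow> nat) \<Rightarrow> nat \<Rightarrow> (nat \<Rightarrow> nat) \<Rightarrow>
    (nat \<Rightarrow> nat list) \<Rightarrow> bool"
where
  "buckets n U W h nx x e D B \<longleftrightarrow>
     (\<forall>d < n. chain nx (h d) (B d) \<and> (\<forall>p \<in> set (B d). p \<le> e \<and> x p \<in> W)) \<and>
     (\<forall>w \<in> U. D w < n \<and> w \<in> x ` set (B (D w)))"

text \<open>The potential of the amortised analysis: 40 times this number is reserved for the pops
  still to come.\<close>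

definition num_nodes :: "nat \<Rightarrow> (nat \<Rightarrow> nat list) \<Rightarrow> nat" where
  "num_nodes n B = (\<Sum>d<n. length (B d))"

lemma num_nodes_upd:
  "d < n \<Longrightarrow> num_nodes n (B(d := qs)) + length (B d) = num_nodes n B + length qs"
  unfolding num_nodes_def by (simp add: sum.remove[of _ d])

lemma buckets_cong:
  assumes "buckets n U W h nx x e D B" "\<forall>w\<in>U'. D' w = D w" "U' \<subseteq> U"
  shows "buckets n U' W h nx x e D' B"
  using assms unfolding buckets_def by auto

text \<open>The node \<open>Suc e\<close> lies on no chain, so writing its cells leaves all existing
  chains intact.\<close>

lemma buckets_push:
  assumes "buckets n U W h nx x e D B" "v \<in> W" "D v < n"
  shows "buckets n (insert v U) W (h(D v := Suc e)) (nx(Suc e := h (D v))) (x(Suc e := v)) (Suc e) D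
    (B(D v := Suc e # B (D v)))"
proof -
  have new: "Suc e \<notin> set (B d)" if "d < n" for d
    using assms(1) that unfolding buckets_def by fastforce
  have ch: "chain (nx(Suc e := q)) p (B d) = chain nx p (B d)" if "d < n" for d p q
    using new[OF that] by (intro chain_cong) auto
  have old: "p \<le> e" "x p \<in> W" "p \<noteq> Suc e" if "d < n" "p \<in> set (B d)" for d p
    using assms(1) that new[OF that(1)] unfolding buckets_def by auto
  show ?thesis
    unfolding buckets_def
  proof (intro conjI allI impI ballI)
    fix d assume d: "d < n"
    have "chain nx (h d) (B d)"
      using assms(1) d by (simp add: buckets_def)
    then show "chain (nx(Suc e := h (D v))) ((h(D v := Suc e)) d) ((B(D v := Suc e # B (D v))) d)"
      using ch[OF d] by auto
  next
    fix w assume w: "w \<in> insert v U"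
    then show "D w < n"
      using assms unfolding buckets_def by auto
    show "w \<in> (x(Suc e := v)) ` set ((B(D v := Suc e # B (D v))) (D w))"
    proof (cases "w = v")
      case True
      then show ?thesis
        by (intro image_eqI[of _ _ "Suc e"]) auto
    next
      case False
      then obtain q where q: "q \<in> set (B (D w))" "w = x q" "D w < n"
        using w assms(1) unfolding buckets_def by auto
      then show ?thesis
        using old[OF q(3,1)] by (intro image_eqI[of _ _ q]) auto
    qed
  next
    fix d p assume "d < n" "p \<in> set ((B(D v := Suc e # B (D v))) d)"
    then show "p \<le> Suc e" "(x(Suc e := v)) p \<in> W"
      using old[of d p] assms(2) by (auto split: if_splits)
  qed
qed

text \<open>The condition on \<open>x p\<close> says that the popped node does not account for any
  vertex of \<open>U'\<close>. This fits both uses: discarding an outdated node, with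
  \<open>U'\<close> equal to \<open>U\<close>, and taking the chosen vertex out of
  \<open>U\<close>.\<close>

lemma buckets_pop:
  assumes "buckets n U W h nx x e D B" "d < n" "B d = p # ps" "x p \<in> U' \<Longrightarrow> D (x p) \<noteq> d" "U' \<subseteq> U"
  shows "buckets n U' W (h(d := nx p)) nx x e D (B(d := ps))"
  unfolding buckets_def
proof (intro conjI allI impI ballI)
  fix w assume w: "w \<in> U'"
  then have "w \<in> U" using assms(5) by blast
  then show "D w < n"
    using assms(1) by (auto simp: buckets_def)
  have "w \<in> x ` set (B (D w))"
    using assms(1) \<open>w \<in> U\<close> by (auto simp: buckets_def)
  moreover have "w \<noteq> x p" if "D w = d"
    using assms(4) w that by auto
  ultimately show "w \<in> x ` set ((B(d := ps)) (D w))"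
    using assms(3) by auto
next
  fix c q assume "c < n" "q \<in> set ((B(d := ps)) c)"
  then have "q \<in> set (B c)"
    using assms(3) by (auto split: if_splits)
  then show "q \<le> e" "x q \<in> W"
    using assms(1) \<open>c < n\<close> by (auto simp: buckets_def)
qed (use assms in \<open>auto simp: buckets_def\<close>)

definition push :: "string \<Rightarrow> com" where
  "push v =
     Assign ''e'' (Add (Reg ''e'') (Num 1)) ;;
     Store ''X'' (Reg ''e'') (Reg v) ;;
     Store ''N'' (Reg ''e'') (Get ''H'' (Get ''D'' (Reg v))) ;;
     Store ''H'' (Get ''D'' (Reg v)) (Reg ''e'')"

text \<open>Since no remaining vertex has degree less than \<open>d\<close>, a node of bucket \<open>d\<close> is up to date unless its
  vertex was removed or has degree greater than \<open>d\<close>.\<close>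

definition find :: com where
  "find =
     Assign ''d'' (Num 0) ;; Assign ''f'' (Num 0) ;;
     While (Less (Reg ''f'') (Num 1))
       (Assign ''p'' (Get ''H'' (Reg ''d'')) ;;
        If (Less (Num 0) (Reg ''p''))
          (Assign ''v'' (Get ''X'' (Reg ''p'')) ;;
           Store ''H'' (Reg ''d'') (Get ''N'' (Reg ''p'')) ;;
           If (And (Less (Num 0) (Get ''a'' (Reg ''v'')))
                (Not (Less (Reg ''d'') (Get ''D'' (Reg ''v'')))))
             (Assign ''f'' (Num 1)) Skip)
          (Assign ''d'' (Add (Reg ''d'') (Num 1))))"

lemma mod_find:
  "mod_regs find = {''d'', ''f'', ''p'', ''v''}" "mod_arrays find = {''H''}"
  by (auto simp: find_def)

text \<open>The bucket of a vertex of minimum degree is never empty before a vertex is accepted, so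
  \<open>d\<close> cannot pass the minimum; an accepted vertex has degree at most \<open>d\<close>
  and is therefore minimal. Every iteration costs less than 40 and either pops a node or passes an
  empty bucket, which is paid by the potential or by the term \<open>40 * d\<close>.\<close>

lemma wp_find:
  assumes bk: "buckets n U W (snd s ''H'') (snd s ''N'') (snd s ''X'') (fst s ''e'') (snd s ''D'') B"
    and U: "U \<noteq> {}" "U \<subseteq> W" "finite U"
    and al: "\<forall>w\<in>W. 0 < snd s ''a'' w \<longleftrightarrow> w \<in> U"
  shows "wp find (\<lambda>t s'. fst s' ''v'' \<in> U \<and> fst s' ''d'' = snd s ''D'' (fst s' ''v'') \<and>
      (\<forall>w\<in>U. fst s' ''d'' \<le> snd s ''D'' w) \<and>
      (\<exists>B'. buckets n (U - {fst s' ''v''}) W (snd s' ''H'') (snd s ''N'') (snd s ''X'') (fst s ''e'')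
          (snd s ''D'') B' \<and>
        t + 40 * num_nodes n B' \<le> 40 * num_nodes n B + 40 * fst s' ''d'' + 20)) s"
proof -
  let ?D = "snd s ''D''" and ?N = "snd s ''N''" and ?X = "snd s ''X''" and ?a = "snd s ''a''"
    and ?e = "fst s ''e''"
  obtain w0 where w0: "w0 \<in> U" "\<forall>w\<in>U. ?D w0 \<le> ?D w"
    using U(1,3) by (metis arg_min_if_finite(1) arg_min_least)
  have w0n: "?D w0 < n"
    using bk w0 by (auto simp: buckets_def)
  \<comment> \<open>\<open>T\<close> is the whole budget. While the search is on, \<open>I\<close>
    also reserves 40 for each bucket between the current \<open>d\<close> and the minimum
    degree.\<close>
  define T where "T = 40 * num_nodes n B + 40 * ?D w0"
  define I where "I = (\<lambda>t (s'::state). snd s' ''N'' = ?N \<and> snd s' ''X'' = ?X \<and> snd s' ''D'' = ?D \<and>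
     snd s' ''a'' = ?a \<and> fst s' ''d'' \<le> ?D w0 \<and>
     (if fst s' ''f'' = 0
      then \<exists>B. buckets n U W (snd s' ''H'') ?N ?X ?e ?D B \<and>
        t + 40 * num_nodes n B + 40 * (?D w0 - fst s' ''d'') \<le> T
      else fst s' ''v'' \<in> U \<and> fst s' ''d'' = ?D (fst s' ''v'') \<and>
        (\<exists>B. buckets n (U - {fst s' ''v''}) W (snd s' ''H'') ?N ?X ?e ?D B \<and>
        t + 40 * num_nodes n B \<le> T)))"
  show ?thesis
    unfolding find_def wp_Seq wp_Assign
  proof (rule wp_While[where I = I and M = T])
    show "I 0 ((fst ((fst s)(''d'' := aval (Num 0) s), snd s))
        (''f'' := aval (Num 0) ((fst s)(''d'' := aval (Num 0) s), snd s)),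
        snd ((fst s)(''d'' := aval (Num 0) s), snd s))"
      using bk by (auto simp: I_def T_def)
  next
    fix t and s' :: state
    assume I: "I t s'" and b: "bval (Less (Reg ''f'') (Num 1)) s'"
    then have f: "fst s' ''f'' = 0" by simp
    let ?d = "fst s' ''d''" and ?H = "snd s' ''H''"
    obtain B1 where bk1: "buckets n U W ?H ?N ?X ?e ?D B1"
      and t: "t + 40 * num_nodes n B1 + 40 * (?D w0 - ?d) \<le> T"
      using I f by (auto simp: I_def)
    have d: "?d \<le> ?D w0" and same: "snd s' ''N'' = ?N" "snd s' ''X'' = ?X" "snd s' ''D'' = ?D"
      "snd s' ''a'' = ?a"
      using I by (auto simp: I_def)
    have dn: "?d < n" using d w0n by simp
    have ch: "chain ?N (?H ?d) (B1 ?d)"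
      using bk1 dn by (auto simp: buckets_def)
    show "wp (Assign ''p'' (Get ''H'' (Reg ''d'')) ;;
        If (Less (Num 0) (Reg ''p''))
          (Assign ''v'' (Get ''X'' (Reg ''p'')) ;;
           Store ''H'' (Reg ''d'') (Get ''N'' (Reg ''p'')) ;;
           If (And (Less (Num 0) (Get ''a'' (Reg ''v'')))
                (Not (Less (Reg ''d'') (Get ''D'' (Reg ''v'')))))
             (Assign ''f'' (Num 1)) Skip)
          (Assign ''d'' (Add (Reg ''d'') (Num 1))))
        (\<lambda>u s'. I (1 + bcost (Less (Reg ''f'') (Num 1)) + t + u) s') s'"
    proof (cases "B1 ?d")
      case Nil
      then have H0: "?H ?d = 0" using ch by simp
      \<comment> \<open>\<open>w0\<close> has a node in the bucket of its degree, so an empty bucket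
        cannot be that one.\<close>
      have "?D w0 \<noteq> ?d"
        using bk1 w0(1) Nil by (auto simp: buckets_def)
      then have "?d < ?D w0" using d by simp
      then have "40 * (?D w0 - ?d) = 40 * (?D w0 - Suc ?d) + 40" by simp
      then show ?thesis
        using t bk1 \<open>?d < ?D w0\<close> by (auto simp: H0 I_def f same intro!: exI[of _ B1])
    next
      case (Cons p ps)
      then have p: "?H ?d = p" "0 < p" using ch by auto
      let ?v = "?X p"
      have vW: "?v \<in> W"
        using bk1 dn Cons by (auto simp: buckets_def)
      have nn: "num_nodes n B1 = Suc (num_nodes n (B1(?d := ps)))"
        using num_nodes_upd[OF dn, of B1 ps] Cons by simp
      show ?thesis
      proof (cases "?v \<in> U \<and> ?D ?v \<le> ?d")
        case True
        then have dv: "?D ?v = ?d" using w0(2) d by force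
        have "buckets n (U - {?v}) W (?H(?d := ?N p)) ?N ?X ?e ?D (B1(?d := ps))"
          by (rule buckets_pop[OF bk1 dn Cons]) auto
        moreover have "t + 40 * num_nodes n (B1(?d := ps)) + 40 \<le> T"
          using t nn by simp
        moreover have "0 < ?a ?v" "?v \<in> U"
          using al vW True by auto
        ultimately show ?thesis
          using d by (simp add: p I_def f same dv) (rule exI[of _ "B1(?d := ps)"], simp)
      next
        case False
        have "buckets n U W (?H(?d := ?N p)) ?N ?X ?e ?D (B1(?d := ps))"
          by (rule buckets_pop[OF bk1 dn Cons]) (use False in auto)
        moreover have "t + 40 * num_nodes n (B1(?d := ps)) + 40 + 40 * (?D w0 - ?d) \<le> T"
          using t nn by simp
        moreover have "?a ?v = 0 \<or> ?d < ?D ?v"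
          using al vW False by auto
        ultimately show ?thesis
          using d by (elim disjE; simp add: p I_def f same)
            (rule exI[of _ "B1(?d := ps)"], simp)+
      qed
    qed
  next
    fix t and s' :: state assume "I t s'"
    then show "t \<le> T" by (auto simp: I_def split: if_splits)
  next
    fix t and s' :: state
    assume I: "I t s'" and b: "\<not> bval (Less (Reg ''f'') (Num 1)) s'"
    then have v: "fst s' ''v'' \<in> U" "fst s' ''d'' = ?D (fst s' ''v'')"
      by (auto simp: I_def)
    obtain B' where B': "buckets n (U - {fst s' ''v''}) W (snd s' ''H'') ?N ?X ?e ?D B'"
      "t + 40 * num_nodes n B' \<le> T"
      using I b by (auto simp: I_def)
    have dm: "fst s' ''d'' = ?D w0"
      using I v w0 by (force simp: I_def)
    show "fst s' ''v'' \<in> U \<and> fst s' ''d'' = ?D (fst s' ''v'') \<and>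
      (\<forall>w\<in>U. fst s' ''d'' \<le> ?D w) \<and>
      (\<exists>B'. buckets n (U - {fst s' ''v''}) W (snd s' ''H'') ?N ?X ?e ?D B' \<and>
        1 + acost (Num 0) + (1 + acost (Num 0) + (1 + bcost (Less (Reg ''f'') (Num 1)) + t)) +
          40 * num_nodes n B' \<le> 40 * num_nodes n B + 40 * fst s' ''d'' + 20)"
      using v dm w0 B' by (auto simp: T_def intro!: exI[of _ B'])
  qed
qed

definition relax :: com where
  "relax = For ''j'' (Get ''L'' (Reg ''v''))
     (Assign ''w'' (Get ''A'' (Add (Get ''S'' (Reg ''v'')) (Reg ''j''))) ;;
      If (Less (Num 0) (Get ''a'' (Reg ''w'')))
        (Store ''D'' (Reg ''w'') (Sub (Get ''D'' (Reg ''w'')) (Num 1)) ;; push ''w'')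
        Skip)"

lemma mod_relax:
  "mod_regs relax = {''j'', ''w'', ''e''}" "mod_arrays relax = {''D'', ''X'', ''N'', ''H''}"
  by (auto simp: relax_def push_def)

text \<open>An entry of the list is charged 100: the cost of one round together with the 40 units
  that the node it may push has to carry.\<close>

lemma wp_relax:
  assumes bk: "buckets n U W (snd s ''H'') (snd s ''N'') (snd s ''X'') (fst s ''e'') (snd s ''D'') B"
    and U: "U \<subseteq> W" and al: "\<forall>w\<in>W. 0 < snd s ''a'' w \<longleftrightarrow> w \<in> U"
    and ls: "distinct ls" "set ls \<subseteq> W" "snd s ''L'' (fst s ''v'') = length ls"
      "\<forall>j<length ls. snd s ''A'' (snd s ''S'' (fst s ''v'') + j) = ls ! j"
  shows "wp relax (\<lambda>t s'.
      (\<forall>w\<in>U. snd s' ''D'' w = snd s ''D'' w - (if w \<in> set ls then 1 else 0)) \<and>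
      (\<exists>B'. buckets n U W (snd s' ''H'') (snd s' ''N'') (snd s' ''X'') (fst s' ''e'') (snd s' ''D'') B'
        \<and> t + 40 * num_nodes n B' \<le> 40 * num_nodes n B + 100 * length ls + 10)) s"
proof -
  let ?v = "fst s ''v''"
  define I where "I = (\<lambda>j t (s'::state).
     fst s' ''v'' = ?v \<and> snd s' ''L'' = snd s ''L'' \<and> snd s' ''A'' = snd s ''A'' \<and>
     snd s' ''S'' = snd s ''S'' \<and> snd s' ''a'' = snd s ''a'' \<and>
     (\<forall>w\<in>U. snd s' ''D'' w = snd s ''D'' w - (if w \<in> set (take j ls) then 1 else 0)) \<and>
     (\<exists>B'. buckets n U W (snd s' ''H'') (snd s' ''N'') (snd s' ''X'') (fst s' ''e'') (snd s' ''D'') B'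
        \<and> t + 40 * num_nodes n B' \<le> 40 * num_nodes n B + 100 * j))"
  show ?thesis
    unfolding relax_def
  proof (rule wp_For[where I = I and N = "length ls" and M = "40 * num_nodes n B + 100 * length ls"])
    show "I 0 0 ((fst s)(''j'' := 0), snd s)"
      using bk by (auto simp: I_def)
  next
    fix i t and s' :: state
    assume I: "I i t s'" and i: "fst s' ''j'' = i" "i < length ls"
    let ?w = "ls ! i" and ?D = "snd s' ''D''"
    obtain B1 where bk1: "buckets n U W (snd s' ''H'') (snd s' ''N'') (snd s' ''X'') (fst s' ''e'') ?D B1"
      and t: "t + 40 * num_nodes n B1 \<le> 40 * num_nodes n B + 100 * i"
      using I by (auto simp: I_def)
    have D: "\<forall>w\<in>U. ?D w = snd s ''D'' w - (if w \<in> set (take i ls) then 1 else 0)"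
      and same: "fst s' ''v'' = ?v" "snd s' ''L'' = snd s ''L''" "snd s' ''A'' = snd s ''A''"
        "snd s' ''S'' = snd s ''S''" "snd s' ''a'' = snd s ''a''"
      using I by (auto simp: I_def)
    have wW: "?w \<in> W" using ls(2) i(2) by auto
    have tk: "set (take (Suc i) ls) = insert ?w (set (take i ls))"
      using i(2) by (simp add: take_Suc_conv_app_nth)
    have nw: "?w \<notin> set (take i ls)"
      using ls(1) i(2) by (auto simp: in_set_conv_nth nth_eq_iff_index_eq)
    have A: "snd s ''A'' (snd s ''S'' ?v + i) = ?w"
      using ls(4) i(2) by simp
    show "wp (Assign ''w'' (Get ''A'' (Add (Get ''S'' (Reg ''v'')) (Reg ''j''))) ;;
      If (Less (Num 0) (Get ''a'' (Reg ''w'')))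
        (Store ''D'' (Reg ''w'') (Sub (Get ''D'' (Reg ''w'')) (Num 1)) ;; push ''w'') Skip)
      (\<lambda>u s'. I (Suc i) (7 + acost (Get ''L'' (Reg ''v'')) + t + u)
        ((fst s')(''j'' := Suc i), snd s')) s'"
    proof (cases "?w \<in> U")
      case False
      then show ?thesis
        using al wW D bk1 t
        by (auto simp: I_def same i A tk intro!: exI[of _ B1])
    next
      case True
      let ?D' = "?D(?w := ?D ?w - 1)"
      have lt: "?D' ?w < n"
        using bk1 True by (auto simp: buckets_def)
      \<comment> \<open>Once its degree is lowered, the old node of \<open>?w\<close> no longer
        accounts for it. The vertex is exempted here and readmitted by the push; the old node stays
        behind as outdated.\<close>
      have "buckets n (U - {?w}) W (snd s' ''H'') (snd s' ''N'') (snd s' ''X'') (fst s' ''e'') ?D' B1"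
        by (rule buckets_cong[OF bk1]) auto
      from buckets_push[OF this wW, OF lt]
      have bk2: "buckets n U W ((snd s' ''H'')(?D' ?w := Suc (fst s' ''e'')))
          ((snd s' ''N'')(Suc (fst s' ''e'') := snd s' ''H'' (?D' ?w)))
          ((snd s' ''X'')(Suc (fst s' ''e'') := ?w)) (Suc (fst s' ''e'')) ?D'
          (B1(?D' ?w := Suc (fst s' ''e'') # B1 (?D' ?w)))" (is "buckets _ _ _ _ _ _ _ _ ?B2")
        using True by (simp add: insert_absorb)
      have nn: "num_nodes n ?B2 = Suc (num_nodes n B1)"
        using num_nodes_upd[OF lt, of B1 "Suc (fst s' ''e'') # B1 (?D' ?w)"] by simp
      have D2: "\<forall>w\<in>U. ?D' w = snd s ''D'' w - (if w \<in> set (take (Suc i) ls) then 1 else 0)"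
        using D tk nw True by auto
      have pos: "0 < snd s ''a'' ?w" using al wW True by simp
      show ?thesis
        using bk2 nn D2 t pos
        by (simp add: I_def same i A push_def) (rule exI[of _ ?B2], simp)
    qed
  next
    fix i t and s' :: state
    assume "I i t s'"
    then show "aval (Get ''L'' (Reg ''v'')) s' = length ls"
      by (auto simp: I_def ls)
  next
    fix i t and s' :: state
    assume "I i t s'" "i \<le> length ls"
    then show "t \<le> 40 * num_nodes n B + 100 * length ls"
      by (auto simp: I_def)
  next
    fix t and s' :: state
    assume "I (length ls) t s'"
    then show "(\<forall>w\<in>U. snd s' ''D'' w = snd s ''D'' w - (if w \<in> set ls then 1 else 0)) \<and>
      (\<exists>B'. buckets n U W (snd s' ''H'') (snd s' ''N'') (snd s' ''X'') (fst s' ''e'') (snd s' ''D'') B'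
        \<and> 5 + acost (Get ''L'' (Reg ''v'')) + t + 40 * num_nodes n B'
          \<le> 40 * num_nodes n B + 100 * length ls + 10)"
      by (auto simp: I_def)
  qed (simp add: push_def)
qed

text \<open>The program \<open>degen\<close> takes the graph from the list \<open>V\<close> of its \<open>nv\<close> vertices; the adjacency list of
  \<open>v\<close> consists of the \<open>L[v]\<close> entries of \<open>A\<close> from position \<open>S[v]\<close> on. It leaves the ordering in \<open>O\<close>.\<close>

definition stored_graph :: "nat ugraph \<Rightarrow> nat list \<Rightarrow> (nat \<Rightarrow> nat list) \<Rightarrow> state \<Rightarrow> bool" where
  "stored_graph g vs nb s \<longleftrightarrow>
     distinct vs \<and> set vs = verts g \<and> fst s ''nv'' = length vs \<and>
     (\<forall>i<length vs. snd s ''V'' i = vs ! i) \<and>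
     (\<forall>v\<in>verts g. distinct (nb v) \<and> set (nb v) = neighbors g v \<and> snd s ''L'' v = length (nb v) \<and>
        (\<forall>j<length (nb v). snd s ''A'' (snd s ''S'' v + j) = nb v ! j))"

lemma stored_graph_cong:
  assumes "stored_graph g vs nb s" "fst s' ''nv'' = fst s ''nv''"
    "snd s' ''V'' = snd s ''V''" "snd s' ''L'' = snd s ''L''" "snd s' ''A'' = snd s ''A''"
    "snd s' ''S'' = snd s ''S''"
  shows "stored_graph g vs nb s'"
  using assms by (simp add: stored_graph_def)

lemma stored_graph_length: "stored_graph g vs nb s \<Longrightarrow> v \<in> verts g \<Longrightarrow> length (nb v) = deg g v"
  unfolding stored_graph_def deg_def by (metis distinct_card)

text \<open>Degrees are below \<open>nv\<close>, so resetting the first \<open>nv\<close> heads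
  clears all buckets in use, whatever an earlier run left in memory. Setting \<open>e\<close> to 0
  makes the cells of old nodes available again. Nothing here depends on the size of the whole
  graph.\<close>

definition prepare :: com where
  "prepare =
     For ''i'' (Reg ''nv'') (Store ''H'' (Reg ''i'') (Num 0)) ;;
     Assign ''e'' (Num 0) ;;
     For ''i'' (Reg ''nv'')
       (Assign ''v'' (Get ''V'' (Reg ''i'')) ;;
        Store ''D'' (Reg ''v'') (Get ''L'' (Reg ''v'')) ;;
        Store ''a'' (Reg ''v'') (Num 1) ;;
        push ''v'')"

lemma mod_prepare:
  "mod_regs prepare = {''i'', ''e'', ''v''}" "mod_arrays prepare = {''H'', ''D'', ''a'', ''X'', ''N''}"
  by (auto simp: prepare_def push_def)

lemma wp_clear:
  "wp (For ''i'' (Reg ''nv'') (Store ''H'' (Reg ''i'') (Num 0)))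
     (\<lambda>t s'. (\<forall>d<fst s ''nv''. snd s' ''H'' d = 0) \<and> t \<le> 20 * fst s ''nv'' + 10) s"
  by (rule wp_For[where N = "fst s ''nv''" and M = "20 * fst s ''nv''" and
        I = "\<lambda>i t s'. fst s' ''nv'' = fst s ''nv'' \<and> (\<forall>d<i. snd s' ''H'' d = 0) \<and> t \<le> 20 * i"])
    (auto simp: less_Suc_eq)

lemma wp_fill:
  assumes g: "simple_graph g" "stored_graph g vs nb s"
    and H: "\<forall>d<length vs. snd s ''H'' d = 0" and e: "fst s ''e'' = 0"
  shows "wp (For ''i'' (Reg ''nv'')
       (Assign ''v'' (Get ''V'' (Reg ''i'')) ;;
        Store ''D'' (Reg ''v'') (Get ''L'' (Reg ''v'')) ;;
        Store ''a'' (Reg ''v'') (Num 1) ;;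
        push ''v''))
     (\<lambda>t s'. (\<forall>v\<in>verts g. snd s' ''a'' v = 1 \<and> snd s' ''D'' v = deg g v) \<and>
        (\<exists>B. buckets (length vs) (verts g) (verts g) (snd s' ''H'') (snd s' ''N'') (snd s' ''X'')
            (fst s' ''e'') (snd s' ''D'') B \<and>
          t + 40 * num_nodes (length vs) B \<le> 100 * length vs + 10)) s"
proof -
  let ?n = "length vs" and ?W = "verts g"
  have vs: "distinct vs" "set vs = ?W" "\<forall>i<?n. snd s ''V'' i = vs ! i"
    and nv: "fst s ''nv'' = ?n" and L: "\<And>v. v \<in> ?W \<Longrightarrow> snd s ''L'' v = deg g v"
    using g stored_graph_length[OF g(2)] by (auto simp: stored_graph_def)
  have n: "card ?W = ?n"
    using vs by (metis distinct_card)
  define I where "I = (\<lambda>i t (s'::state). fst s' ''nv'' = ?n \<and> snd s' ''V'' = snd s ''V'' \<and>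
     snd s' ''L'' = snd s ''L'' \<and>
     (\<forall>v\<in>set (take i vs). snd s' ''a'' v = 1 \<and> snd s' ''D'' v = deg g v) \<and>
     (\<exists>B. buckets ?n (set (take i vs)) ?W (snd s' ''H'') (snd s' ''N'') (snd s' ''X'')
         (fst s' ''e'') (snd s' ''D'') B \<and>
       t + 40 * num_nodes ?n B \<le> 100 * i))"
  show ?thesis
  proof (rule wp_For[where I = I and N = ?n and M = "100 * ?n"])
    have "buckets ?n {} ?W (snd s ''H'') (snd s ''N'') (snd s ''X'') (fst s ''e'') (snd s ''D'')
        (\<lambda>_. [])"
      using H by (simp add: buckets_def)
    then show "I 0 0 ((fst s)(''i'' := 0), snd s)"
      using nv by (simp add: I_def) (rule exI[of _ "\<lambda>_. []"], simp add: num_nodes_def)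
  next
    fix i t and s' :: state
    assume I: "I i t s'" and i: "fst s' ''i'' = i" "i < ?n"
    let ?v = "vs ! i" and ?D = "snd s' ''D''"
    obtain B1 where bk1: "buckets ?n (set (take i vs)) ?W (snd s' ''H'') (snd s' ''N'') (snd s' ''X'')
         (fst s' ''e'') ?D B1"
      and t: "t + 40 * num_nodes ?n B1 \<le> 100 * i"
      using I by (auto simp: I_def)
    have old: "\<forall>v\<in>set (take i vs). snd s' ''a'' v = 1 \<and> ?D v = deg g v"
      and same: "fst s' ''nv'' = ?n" "snd s' ''V'' = snd s ''V''" "snd s' ''L'' = snd s ''L''"
      using I unfolding I_def by blast+
    have vW: "?v \<in> ?W" using nth_mem[OF i(2)] vs(2) by simp
    have V: "snd s ''V'' i = ?v" using vs(3) i(2) by simp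
    have tk: "set (take (Suc i) vs) = insert ?v (set (take i vs))"
      using i(2) by (simp add: take_Suc_conv_app_nth)
    let ?D' = "?D(?v := deg g ?v)"
    \<comment> \<open>A degree is less than the number of vertices, so \<open>length vs\<close>
      buckets suffice.\<close>
    have lt: "?D' ?v < ?n"
      using deg_less_card[OF g(1) vW] n by simp
    have "buckets ?n (set (take i vs)) ?W (snd s' ''H'') (snd s' ''N'') (snd s' ''X'')
        (fst s' ''e'') ?D' B1"
      by (rule buckets_cong[OF bk1]) (use old in auto)
    from buckets_push[OF this vW, OF lt]
    have bk2: "buckets ?n (set (take (Suc i) vs)) ?W ((snd s' ''H'')(?D' ?v := Suc (fst s' ''e'')))
        ((snd s' ''N'')(Suc (fst s' ''e'') := snd s' ''H'' (?D' ?v)))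
        ((snd s' ''X'')(Suc (fst s' ''e'') := ?v)) (Suc (fst s' ''e'')) ?D'
        (B1(?D' ?v := Suc (fst s' ''e'') # B1 (?D' ?v)))" (is "buckets _ _ _ _ _ _ _ _ ?B2")
      by (simp only: tk)
    have nn: "num_nodes ?n ?B2 = Suc (num_nodes ?n B1)"
      using num_nodes_upd[OF lt, of B1 "Suc (fst s' ''e'') # B1 (?D' ?v)"] by simp
    have new: "\<forall>v\<in>set (take (Suc i) vs). v \<noteq> ?v \<longrightarrow> snd s' ''a'' v = 1 \<and> ?D v = deg g v"
      using old tk by auto
    show "wp (Assign ''v'' (Get ''V'' (Reg ''i'')) ;;
        Store ''D'' (Reg ''v'') (Get ''L'' (Reg ''v'')) ;;
        Store ''a'' (Reg ''v'') (Num 1) ;;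
        push ''v'')
      (\<lambda>u s'. I (Suc i) (7 + acost (Reg ''nv'') + t + u) ((fst s')(''i'' := Suc i), snd s')) s'"
      using bk2 nn new t
      by (simp add: I_def same i V L[OF vW] push_def) (rule exI[of _ ?B2], simp)
  next
    fix t and s' :: state
    assume "I ?n t s'"
    then show "(\<forall>v\<in>verts g. snd s' ''a'' v = 1 \<and> snd s' ''D'' v = deg g v) \<and>
        (\<exists>B. buckets ?n ?W ?W (snd s' ''H'') (snd s' ''N'') (snd s' ''X'')
            (fst s' ''e'') (snd s' ''D'') B \<and>
          5 + acost (Reg ''nv'') + t + 40 * num_nodes ?n B \<le> 100 * ?n + 10)"
      using vs(2) by (auto simp: I_def)
  qed (auto simp: I_def push_def)
qed

lemma wp_prepare:
  assumes g: "simple_graph g" "stored_graph g vs nb s"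
  shows "wp prepare
     (\<lambda>t s'. (\<forall>v\<in>verts g. snd s' ''a'' v = 1 \<and> snd s' ''D'' v = deg g v) \<and>
        (\<exists>B. buckets (length vs) (verts g) (verts g) (snd s' ''H'') (snd s' ''N'') (snd s' ''X'')
            (fst s' ''e'') (snd s' ''D'') B \<and>
          t + 40 * num_nodes (length vs) B \<le> 150 * length vs + 50)) s"
proof -
  have nv: "fst s ''nv'' = length vs"
    using g(2) by (simp add: stored_graph_def)
  show ?thesis
    unfolding prepare_def wp_Seq[where P = "For x y z" for x y z] wp_Seq[where P = "Assign x y" for x y]
      wp_Assign
  proof (rule wp_conseq_frame[OF wp_clear], rule wp_conseq_frame[OF wp_fill[OF g(1)]])
    fix t :: nat and s' s2 :: state
    assume H: "(\<forall>d<fst s ''nv''. snd s' ''H'' d = 0) \<and> t \<le> 20 * fst s ''nv'' + 10"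
      and fr: "\<And>x. x \<notin> mod_regs (For ''i'' (Reg ''nv'') (Store ''H'' (Reg ''i'') (Num 0))) \<Longrightarrow>
        fst s' x = fst s x"
      "\<And>X. X \<notin> mod_arrays (For ''i'' (Reg ''nv'') (Store ''H'' (Reg ''i'') (Num 0))) \<Longrightarrow>
        snd s' X = snd s X"
    let ?s = "((fst s')(''e'' := aval (Num 0) s'), snd s')"
    show "stored_graph g vs nb ?s"
      by (rule stored_graph_cong[OF g(2)]) (simp_all add: fr)
    show "\<forall>d<length vs. snd ?s ''H'' d = 0"
      using H nv by simp
    show "fst ?s ''e'' = 0" by simp
  next
    fix t1 t2 :: nat and s1 s2 :: state
    assume "(\<forall>d<fst s ''nv''. snd s1 ''H'' d = 0) \<and> t1 \<le> 20 * fst s ''nv'' + 10"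
    moreover assume "(\<forall>v\<in>verts g. snd s2 ''a'' v = 1 \<and> snd s2 ''D'' v = deg g v) \<and>
        (\<exists>B. buckets (length vs) (verts g) (verts g) (snd s2 ''H'') (snd s2 ''N'') (snd s2 ''X'')
            (fst s2 ''e'') (snd s2 ''D'') B \<and>
          t2 + 40 * num_nodes (length vs) B \<le> 100 * length vs + 10)"
    ultimately show "(\<forall>v\<in>verts g. snd s2 ''a'' v = 1 \<and> snd s2 ''D'' v = deg g v) \<and>
        (\<exists>B. buckets (length vs) (verts g) (verts g) (snd s2 ''H'') (snd s2 ''N'') (snd s2 ''X'')
            (fst s2 ''e'') (snd s2 ''D'') B \<and>
          t1 + (1 + acost (Num 0) + t2) + 40 * num_nodes (length vs) B \<le> 150 * length vs + 50)"
      unfolding nv by (elim conjE exE) (intro conjI exI, assumption+, simp)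
  qed
qed

section \<open>Removing the vertices one by one\<close>

definition rounds :: com where
  "rounds = For ''i'' (Reg ''nv'')
     (find ;;
      Store ''O'' (Reg ''i'') (Reg ''v'') ;;
      Store ''R'' (Reg ''i'') (Reg ''d'') ;;
      Store ''a'' (Reg ''v'') (Num 0) ;;
      relax)"

lemma mod_rounds:
  "mod_regs rounds = {''i'', ''d'', ''f'', ''p'', ''v'', ''j'', ''w'', ''e''}"
  "mod_arrays rounds = {''H'', ''O'', ''R'', ''a'', ''D'', ''X'', ''N''}"
  by (auto simp: rounds_def mod_find mod_relax)

text \<open>The search costs \<open>40 * d\<close> beyond what the potential pays, and
  \<open>d\<close>, the degree of the removed vertex in what remains, is at most its degree in
  \<open>g\<close>. Scanning its adjacency list is linear in that degree too, so both costs are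
  charged to the removed vertex. \<open>D\<close> is kept correct for the remaining vertices
  only.\<close>

lemma wp_rounds:
  assumes g: "simple_graph g" "stored_graph g vs nb s"
    and init: "\<forall>v\<in>verts g. snd s ''a'' v = 1 \<and> snd s ''D'' v = deg g v"
    and bk: "buckets (length vs) (verts g) (verts g) (snd s ''H'') (snd s ''N'') (snd s ''X'')
            (fst s ''e'') (snd s ''D'') B"
  shows "wp rounds (\<lambda>t s'. (\<exists>os rs. peeling g os rs \<and> set os = verts g \<and> length os = length vs \<and>
        (\<forall>j<length vs. snd s' ''O'' j = os ! j \<and> snd s' ''R'' j = rs ! j)) \<and>
      t \<le> 40 * num_nodes (length vs) B + 200 * length vs + 200 * (\<Sum>v\<in>verts g. deg g v) + 10) s"
proof -
  let ?n = "length vs" and ?W = "verts g"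
  have W: "finite ?W" using g(1) by (simp add: simple_graph_def)
  have vs: "distinct vs" "set vs = ?W" and nv: "fst s ''nv'' = ?n"
    using g by (auto simp: stored_graph_def)
  have n: "card ?W = ?n"
    using vs by (metis distinct_card)
  define J where "J = (\<lambda>os rs i t (s'::state). stored_graph g vs nb s' \<and> length os = i \<and>
     peeling g os rs \<and> (\<forall>j<i. snd s' ''O'' j = os ! j \<and> snd s' ''R'' j = rs ! j) \<and>
     (\<forall>w\<in>?W. 0 < snd s' ''a'' w \<longleftrightarrow> w \<in> ?W - set os) \<and>
     (\<forall>w\<in>?W - set os. snd s' ''D'' w = deg (induced g (?W - set os)) w) \<and>
     (\<exists>B'. buckets ?n (?W - set os) ?W (snd s' ''H'') (snd s' ''N'') (snd s' ''X'')
         (fst s' ''e'') (snd s' ''D'') B' \<and>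
       t + 40 * num_nodes ?n B' \<le> 40 * num_nodes ?n B + 200 * i + 200 * (\<Sum>v\<in>set os. deg g v)))"
  have J_time: "t \<le> 40 * num_nodes ?n B + 200 * i + 200 * (\<Sum>v\<in>?W. deg g v)"
    if "J os rs i t s'" for os rs i t s'
  proof -
    have "(\<Sum>v\<in>set os. deg g v) \<le> (\<Sum>v\<in>?W. deg g v)"
      using that W by (intro sum_mono2) (auto simp: J_def peeling_def)
    then show ?thesis
      using that by (auto simp: J_def)
  qed
  show ?thesis
    unfolding rounds_def
  proof (rule wp_For[where I = "\<lambda>i t s'. \<exists>os rs. J os rs i t s'" and N = ?n and
        M = "40 * num_nodes ?n B + 200 * ?n + 200 * (\<Sum>v\<in>?W. deg g v)"])
    have "stored_graph g vs nb ((fst s)(''i'' := 0), snd s)"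
      by (rule stored_graph_cong[OF g(2)]) auto
    then show "\<exists>os rs. J os rs 0 0 ((fst s)(''i'' := 0), snd s)"
      using init bk by (intro exI[of _ "[]"]) (auto simp: J_def peeling_Nil induced_verts[OF g(1)])
  next
    fix i t and s1 :: state
    assume "\<exists>os rs. J os rs i t s1" and i: "fst s1 ''i'' = i" "i < ?n"
    then obtain os rs where J: "J os rs i t s1" by blast
    let ?U = "?W - set os"
    have st1: "stored_graph g vs nb s1" and os: "length os = i" "peeling g os rs"
      and OR: "\<forall>j<i. snd s1 ''O'' j = os ! j \<and> snd s1 ''R'' j = rs ! j"
      and al: "\<forall>w\<in>?W. 0 < snd s1 ''a'' w \<longleftrightarrow> w \<in> ?U"
      and D1: "\<forall>w\<in>?U. snd s1 ''D'' w = deg (induced g ?U) w"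
      using J by (auto simp: J_def)
    obtain B1 where bk1: "buckets ?n ?U ?W (snd s1 ''H'') (snd s1 ''N'') (snd s1 ''X'')
         (fst s1 ''e'') (snd s1 ''D'') B1"
      and t1: "t + 40 * num_nodes ?n B1 \<le> 40 * num_nodes ?n B + 200 * i + 200 * (\<Sum>v\<in>set os. deg g v)"
      using J by (auto simp: J_def)
    have len_rs: "length rs = i"
      using os by (simp add: peeling_def)
    have "card (set os) = i"
      using os by (simp add: peeling_def distinct_card)
    then have "?U \<noteq> {}"
      using i(2) n W by (metis Diff_eq_empty_iff List.finite_set card_mono not_le)
    show "wp (find ;;
        Store ''O'' (Reg ''i'') (Reg ''v'') ;;
        Store ''R'' (Reg ''i'') (Reg ''d'') ;;
        Store ''a'' (Reg ''v'') (Num 0) ;;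
        relax)
      (\<lambda>u s'. \<exists>os rs. J os rs (Suc i) (7 + acost (Reg ''nv'') + t + u)
         ((fst s')(''i'' := Suc i), snd s')) s1"
      unfolding wp_Seq[where P = find]
    proof (rule wp_conseq_frame[OF wp_find[OF bk1 \<open>?U \<noteq> {}\<close> _ _ al]])
      fix t2 and s2 :: state
      let ?v = "fst s2 ''v''" and ?d = "fst s2 ''d''"
      assume post: "?v \<in> ?U \<and> ?d = snd s1 ''D'' ?v \<and>
          (\<forall>w\<in>?U. ?d \<le> snd s1 ''D'' w) \<and>
          (\<exists>B'. buckets ?n (?U - {?v}) ?W (snd s2 ''H'') (snd s1 ''N'') (snd s1 ''X'') (fst s1 ''e'')
              (snd s1 ''D'') B' \<and>
            t2 + 40 * num_nodes ?n B' \<le> 40 * num_nodes ?n B1 + 40 * ?d + 20)"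
        and regs: "\<And>x. x \<notin> mod_regs find \<Longrightarrow> fst s2 x = fst s1 x"
        and arrays: "\<And>X. X \<notin> mod_arrays find \<Longrightarrow> snd s2 X = snd s1 X"
      have fr: "fst s2 ''i'' = i" "fst s2 ''e'' = fst s1 ''e''" "fst s2 ''nv'' = fst s1 ''nv''"
        "\<And>X. X \<noteq> ''H'' \<Longrightarrow> snd s2 X = snd s1 X"
        using i(1) by (simp_all add: regs arrays mod_find)
      obtain B2 where bk2: "buckets ?n (?U - {?v}) ?W (snd s2 ''H'') (snd s2 ''N'') (snd s2 ''X'')
          (fst s2 ''e'') (snd s2 ''D'') B2"
        and t2: "t2 + 40 * num_nodes ?n B2 \<le> 40 * num_nodes ?n B1 + 40 * ?d + 20"
        using post fr by auto
      have v: "?v \<in> ?W" "?v \<notin> set os" using post by auto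
      let ?O = "(snd s2 ''O'')(i := ?v)" and ?R = "(snd s2 ''R'')(i := ?d)"
      let ?s = "(fst s2, (snd s2)(''O'' := ?O, ''R'' := ?R, ''a'' := (snd s2 ''a'')(?v := 0)))"
      let ?os = "os @ [?v]" and ?rs = "rs @ [?d]"
      have U': "?W - set ?os = ?U - {?v}" by auto
      have d: "?d = deg (induced g ?U) ?v" "\<forall>w\<in>?U. ?d \<le> deg (induced g ?U) w"
        using post D1 by auto
      have d_le: "?d \<le> deg g ?v"
        using finite_neighbors[OF g(1)] post
        by (auto simp: d(1) deg_def neighbors_induced intro!: card_mono)
      have peel: "peeling g ?os ?rs"
        using peeling_snoc[OF os(2) _ d] post by blast
      have st2: "stored_graph g vs nb ?s"
        by (rule stored_graph_cong[OF st1]) (simp_all add: fr)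
      have "wp relax (\<lambda>u s'. \<exists>os rs. J os rs (Suc i) (7 + acost (Reg ''nv'') + t + (t2 + (3 + (3 + (3 + u)))))
          ((fst s')(''i'' := Suc i), snd s')) ?s"
      proof (rule wp_conseq_frame[OF wp_relax[where n = ?n and U = "?U - {?v}" and W = ?W and B = B2
            and ls = "nb ?v"]])
        show "buckets ?n (?U - {?v}) ?W (snd ?s ''H'') (snd ?s ''N'') (snd ?s ''X'') (fst ?s ''e'')
            (snd ?s ''D'') B2"
          using bk2 by simp
        show "?U - {?v} \<subseteq> ?W" by blast
        show "\<forall>w\<in>?W. 0 < snd ?s ''a'' w \<longleftrightarrow> w \<in> ?U - {?v}"
          using al by (auto simp: fr)
        show "distinct (nb ?v)" "set (nb ?v) \<subseteq> ?W" "snd ?s ''L'' (fst ?s ''v'') = length (nb ?v)"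
          "\<forall>j<length (nb ?v). snd ?s ''A'' (snd ?s ''S'' (fst ?s ''v'') + j) = nb ?v ! j"
          using st2 v neighbors_subset[OF g(1), of ?v] by (auto simp: stored_graph_def)
      next
        fix u and s3 :: state
        assume post3: "(\<forall>w\<in>?U - {?v}. snd s3 ''D'' w = snd ?s ''D'' w - (if w \<in> set (nb ?v) then 1 else 0)) \<and>
          (\<exists>B'. buckets ?n (?U - {?v}) ?W (snd s3 ''H'') (snd s3 ''N'') (snd s3 ''X'') (fst s3 ''e'')
             (snd s3 ''D'') B' \<and> u + 40 * num_nodes ?n B' \<le> 40 * num_nodes ?n B2 + 100 * length (nb ?v) + 10)"
          and regs: "\<And>x. x \<notin> mod_regs relax \<Longrightarrow> fst s3 x = fst ?s x"
          and arrays: "\<And>X. X \<notin> mod_arrays relax \<Longrightarrow> snd s3 X = snd ?s X"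
        have fr3: "fst s3 ''nv'' = fst ?s ''nv''"
          "snd s3 ''V'' = snd ?s ''V''" "snd s3 ''L'' = snd ?s ''L''" "snd s3 ''A'' = snd ?s ''A''"
          "snd s3 ''S'' = snd ?s ''S''"
          "snd s3 ''O'' = ?O" "snd s3 ''R'' = ?R" "snd s3 ''a'' = (snd s1 ''a'')(?v := 0)"
          by (simp_all add: regs arrays mod_relax fr)
        obtain B3 where bk3: "buckets ?n (?W - set ?os) ?W (snd s3 ''H'') (snd s3 ''N'') (snd s3 ''X'')
            (fst s3 ''e'') (snd s3 ''D'') B3"
          and t3: "u + 40 * num_nodes ?n B3 \<le> 40 * num_nodes ?n B2 + 100 * length (nb ?v) + 10"
          using post3 unfolding U' by blast
        have len: "length (nb ?v) = deg g ?v" "set (nb ?v) = neighbors g ?v"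
          using stored_graph_length[OF st1 v(1)] st1 v(1) by (simp_all add: stored_graph_def)
        have "stored_graph g vs nb s3"
          by (rule stored_graph_cong[OF st2 fr3(1-5)])
        then have st3: "stored_graph g vs nb ((fst s3)(''i'' := Suc i), snd s3)"
          by (rule stored_graph_cong) auto
        \<comment> \<open>Removing \<open>?v\<close> lowers by one exactly the degrees of its
          remaining neighbors, which are the entries that \<open>relax\<close> has
          decremented.\<close>
        have D3: "\<forall>w\<in>?W - set ?os. snd s3 ''D'' w = deg (induced g (?W - set ?os)) w"
        proof
          fix w assume "w \<in> ?W - set ?os"
          then have w: "w \<in> ?U" "w \<noteq> ?v" by auto
          then show "snd s3 ''D'' w = deg (induced g (?W - set ?os)) w"
            unfolding U' using post3 D1 deg_induced_remove[OF g(1) w, of] post len(2)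
            by (simp add: fr)
        qed
        have OR3: "\<forall>j<Suc i. snd s3 ''O'' j = ?os ! j \<and> snd s3 ''R'' j = ?rs ! j"
          using OR os(1) len_rs by (auto simp: fr3 fr nth_append less_Suc_eq)
        have al3: "\<forall>w\<in>?W. 0 < snd s3 ''a'' w \<longleftrightarrow> w \<in> ?W - set ?os"
          using al by (auto simp: fr3)
        have "(\<Sum>v\<in>set ?os. deg g v) = (\<Sum>v\<in>set os. deg g v) + deg g ?v"
          using v by simp
        then have t3': "7 + acost (Reg ''nv'') + t + (t2 + (3 + (3 + (3 + u)))) + 40 * num_nodes ?n B3
            \<le> 40 * num_nodes ?n B + 200 * Suc i + 200 * (\<Sum>v\<in>set ?os. deg g v)"
          using t1 t2 t3 d_le len(1) by simp
        have "J ?os ?rs (Suc i) (7 + acost (Reg ''nv'') + t + (t2 + (3 + (3 + (3 + u)))))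
            ((fst s3)(''i'' := Suc i), snd s3)"
          unfolding J_def using st3 os(1) peel OR3 al3 D3 bk3 t3'
          by (simp del: set_append acost.simps) blast
        then show "\<exists>os rs. J os rs (Suc i) (7 + acost (Reg ''nv'') + t + (t2 + (3 + (3 + (3 + u)))))
            ((fst s3)(''i'' := Suc i), snd s3)"
          by blast
      qed
      then show "wp (Store ''O'' (Reg ''i'') (Reg ''v'') ;;
        Store ''R'' (Reg ''i'') (Reg ''d'') ;;
        Store ''a'' (Reg ''v'') (Num 0) ;;
        relax)
        (\<lambda>u s'. \<exists>os rs. J os rs (Suc i) (7 + acost (Reg ''nv'') + t + (t2 + u))
          ((fst s')(''i'' := Suc i), snd s')) s2"
        by (simp add: fr(1))
    qed (use W in auto)
  next
    fix t and s1 :: state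
    assume "\<exists>os rs. J os rs ?n t s1"
    then obtain os rs where J: "J os rs ?n t s1" by blast
    have "set os = ?W"
      using J W n by (intro card_subset_eq) (auto simp: J_def peeling_def distinct_card)
    then show "(\<exists>os rs. peeling g os rs \<and> set os = ?W \<and> length os = ?n \<and>
        (\<forall>j<?n. snd s1 ''O'' j = os ! j \<and> snd s1 ''R'' j = rs ! j)) \<and>
      5 + acost (Reg ''nv'') + t
        \<le> 40 * num_nodes ?n B + 200 * ?n + 200 * (\<Sum>v\<in>?W. deg g v) + 10"
      using J J_time[OF J] by (auto simp: J_def)
  next
    fix i t and s1 :: state
    assume "\<exists>os rs. J os rs i t s1"
    then show "aval (Reg ''nv'') s1 = ?n"
      by (auto simp: J_def stored_graph_def)
  next
    fix i t and s1 :: state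
    assume "\<exists>os rs. J os rs i t s1" "i \<le> ?n"
    then show "t \<le> 40 * num_nodes ?n B + 200 * ?n + 200 * (\<Sum>v\<in>?W. deg g v)"
      using J_time by fastforce
  qed (simp add: mod_find mod_relax)
qed

text \<open>\<open>q\<close> is the number of non-edges of the suffix from \<open>b\<close> on; the vertex at \<open>b - 1\<close> is adjacent to
  \<open>R[b - 1]\<close> of its \<open>nv - b\<close> vertices.\<close>

definition suffix_search :: com where
  "suffix_search =
     Assign ''b'' (Reg ''nv'') ;; Assign ''q'' (Num 0) ;;
     While (And (Less (Num 0) (Reg ''b''))
         (Not (Less (Reg ''k'') (Sub (Add (Reg ''q'') (Sub (Reg ''nv'') (Reg ''b'')))
            (Get ''R'' (Sub (Reg ''b'') (Num 1)))))))
       (Assign ''q'' (Sub (Add (Reg ''q'') (Sub (Reg ''nv'') (Reg ''b'')))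
            (Get ''R'' (Sub (Reg ''b'') (Num 1)))) ;;
        Assign ''b'' (Sub (Reg ''b'') (Num 1)))"

lemma mod_suffix_search:
  "mod_regs suffix_search = {''b'', ''q''}" "mod_arrays suffix_search = {}"
  by (auto simp: suffix_search_def)

text \<open>The loop starts from the empty suffix and stops when \<open>b\<close> is 0 or the next
  longer suffix has too many non-edges: these are the hypotheses of \<open>Degen_drop\<close>. For
  \<open>b = 0\<close> the test reads \<open>R[0]\<close>, but its first conjunct already
  fails.\<close>

lemma wp_suffix_search:
  assumes g: "simple_graph g" and os: "peeling g os rs" "set os = verts g"
    and nv: "fst s ''nv'' = length os" and R: "\<forall>j<length os. snd s ''R'' j = rs ! j"
  shows "wp suffix_search (\<lambda>t s'. fst s' ''b'' \<le> length os \<and>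
      Degen g (fst s ''k'') (set (drop (fst s' ''b'') os)) \<and> t \<le> 60 * length os + 30) s"
proof -
  let ?n = "length os" and ?k = "fst s ''k''"
  let ?ne = "\<lambda>b. card (non_edges (induced g (set (drop b os))))"
  define I where "I = (\<lambda>t (s'::state). fst s' ''b'' \<le> ?n \<and> fst s' ''nv'' = ?n \<and> fst s' ''k'' = ?k \<and>
     snd s' ''R'' = snd s ''R'' \<and> fst s' ''q'' = ?ne (fst s' ''b'') \<and> fst s' ''q'' \<le> ?k \<and>
     t \<le> 60 * (?n - fst s' ''b''))"
  \<comment> \<open>The truncated subtraction is exact, since the additive recurrence shows that the
    subtrahend does not exceed the rest.\<close>
  have step: "?ne (b - 1) = ?ne b + (?n - b) - snd s ''R'' (b - 1)" if "0 < b" "b \<le> ?n" for b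
  proof -
    have "b - 1 < ?n" using that by linarith
    then show ?thesis
      using peeling_non_edges_Suc[OF g os, of "b - 1"] that R by simp
  qed
  have "non_edges (induced g {}) = {}"
    by (auto simp: non_edges_def)
  then have ne0: "card (non_edges (induced g {})) = 0" by simp
  show ?thesis
    unfolding suffix_search_def wp_Seq wp_Assign
  proof (rule wp_While[where I = I and M = "60 * ?n"])
    fix t and s' :: state
    assume I: "I t s'" and b: "\<not> bval (And (Less (Num 0) (Reg ''b''))
         (Not (Less (Reg ''k'') (Sub (Add (Reg ''q'') (Sub (Reg ''nv'') (Reg ''b'')))
            (Get ''R'' (Sub (Reg ''b'') (Num 1))))))) s'"
    have "Degen g ?k (set (drop (fst s' ''b'') os))"
      by (rule Degen_drop[OF g peeling_degeneracy_ordering[OF os]])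
        (use I b step[of "fst s' ''b''"] in \<open>auto simp: I_def\<close>)
    then show "fst s' ''b'' \<le> ?n \<and> Degen g ?k (set (drop (fst s' ''b'') os)) \<and>
      1 + acost (Reg ''nv'') + (1 + acost (Num 0) + (1 + bcost (And (Less (Num 0) (Reg ''b''))
         (Not (Less (Reg ''k'') (Sub (Add (Reg ''q'') (Sub (Reg ''nv'') (Reg ''b'')))
            (Get ''R'' (Sub (Reg ''b'') (Num 1))))))) + t)) \<le> 60 * ?n + 30"
      using I by (auto simp: I_def)
  qed (use step in \<open>auto simp: I_def nv ne0\<close>)
qed

definition degen :: com where
  "degen = prepare ;; rounds ;; suffix_search"

lemma mod_degen:
  "mod_regs degen = {''i'', ''e'', ''v'', ''d'', ''f'', ''p'', ''j'', ''w'', ''b'', ''q''}"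
  "mod_arrays degen = {''H'', ''D'', ''a'', ''X'', ''N'', ''O'', ''R''}"
  by (auto simp: degen_def mod_prepare mod_rounds mod_suffix_search)

text \<open>\<open>prepare\<close> leaves nodes whose potential is what \<open>rounds\<close>
  consumes, so \<open>num_nodes\<close> cancels in the sum. The ordering is reported besides the
  solution because the main program goes on to use it.\<close>

lemma wp_degen:
  assumes g: "simple_graph g" "stored_graph g vs nb s"
  shows "wp degen (\<lambda>t s'. (\<exists>os. degeneracy_ordering g os \<and> length os = length vs \<and>
        (\<forall>j<length vs. snd s' ''O'' j = os ! j) \<and> fst s' ''b'' \<le> length vs \<and>
        Degen g (fst s ''k'') (set (drop (fst s' ''b'') os))) \<and>
      t \<le> 500 * length vs + 200 * (\<Sum>v\<in>verts g. deg g v) + 100) s"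
  unfolding degen_def wp_Seq
proof (rule wp_conseq_frame[OF wp_prepare[OF g]], elim conjE exE)
  fix t1 B and s1 :: state
  assume init: "\<forall>v\<in>verts g. snd s1 ''a'' v = 1 \<and> snd s1 ''D'' v = deg g v"
    and bk: "buckets (length vs) (verts g) (verts g) (snd s1 ''H'') (snd s1 ''N'') (snd s1 ''X'')
            (fst s1 ''e'') (snd s1 ''D'') B"
    and t1: "t1 + 40 * num_nodes (length vs) B \<le> 150 * length vs + 50"
    and fr1: "\<And>x. x \<notin> mod_regs prepare \<Longrightarrow> fst s1 x = fst s x"
      "\<And>X. X \<notin> mod_arrays prepare \<Longrightarrow> snd s1 X = snd s X"
  have st1: "stored_graph g vs nb s1"
    by (rule stored_graph_cong[OF g(2)]) (simp_all add: fr1 mod_prepare)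
  show "wp rounds (\<lambda>t s'. wp suffix_search (\<lambda>u s''. (\<exists>os. degeneracy_ordering g os \<and>
        length os = length vs \<and> (\<forall>j<length vs. snd s'' ''O'' j = os ! j) \<and>
        fst s'' ''b'' \<le> length vs \<and> Degen g (fst s ''k'') (set (drop (fst s'' ''b'') os))) \<and>
      t1 + (t + u) \<le> 500 * length vs + 200 * (\<Sum>v\<in>verts g. deg g v) + 100) s') s1"
  proof (rule wp_conseq_frame[OF wp_rounds[OF g(1) st1 init bk]], elim conjE exE)
    fix t2 os rs and s2 :: state
    assume os: "peeling g os rs" "set os = verts g" "length os = length vs"
      and OR: "\<forall>j<length vs. snd s2 ''O'' j = os ! j \<and> snd s2 ''R'' j = rs ! j"
      and t2: "t2 \<le> 40 * num_nodes (length vs) B + 200 * length vs + 200 * (\<Sum>v\<in>verts g. deg g v) + 10"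
      and fr2: "\<And>x. x \<notin> mod_regs rounds \<Longrightarrow> fst s2 x = fst s1 x"
    have r2: "fst s2 ''nv'' = length os" "fst s2 ''k'' = fst s ''k''"
      using st1 fr1(1) fr2 os(3) by (auto simp: mod_rounds mod_prepare stored_graph_def)
    show "wp suffix_search (\<lambda>u s''. (\<exists>os. degeneracy_ordering g os \<and>
        length os = length vs \<and> (\<forall>j<length vs. snd s'' ''O'' j = os ! j) \<and>
        fst s'' ''b'' \<le> length vs \<and> Degen g (fst s ''k'') (set (drop (fst s'' ''b'') os))) \<and>
      t1 + (t2 + u) \<le> 500 * length vs + 200 * (\<Sum>v\<in>verts g. deg g v) + 100) s2"
    proof (rule wp_conseq_frame[OF wp_suffix_search[OF g(1) os(1,2) r2(1)]])
      show "\<forall>j<length os. snd s2 ''R'' j = rs ! j"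
        using OR os(3) by simp
    qed (use os OR r2 t1 t2 peeling_degeneracy_ordering[OF os(1,2)] in
        \<open>auto simp: mod_suffix_search intro!: exI[of _ os]\<close>)
  qed
qed

section \<open>The program for \<open>Degen_opt\<close>\<close>

definition offset :: "nat list list \<Rightarrow> nat \<Rightarrow> nat" where
  "offset ns v = length (concat (take v ns))"

lemma offset_0 [simp]: "offset ns 0 = 0"
  by (simp add: offset_def)

lemma offset_Suc: "v < length ns \<Longrightarrow> offset ns (Suc v) = offset ns v + length (ns ! v)"
  by (simp add: offset_def take_Suc_conv_app_nth)

lemma offset_mono: "v \<le> w \<Longrightarrow> w \<le> length ns \<Longrightarrow> offset ns v \<le> offset ns w"
  by (induction w rule: dec_induct) (auto simp: offset_Suc)

lemma nth_concat_offset: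
  assumes "v < length ns" "j < length (ns ! v)"
  shows "concat ns ! (offset ns v + j) = ns ! v ! j"
proof -
  have "concat ns = concat (take v ns) @ ns ! v @ concat (drop (Suc v) ns)"
    using id_take_nth_drop[OF assms(1)] by (metis concat.simps(2) concat_append)
  then show ?thesis
    using assms(2) by (simp add: offset_def nth_append)
qed

text \<open>Records only the cells that hold input and says nothing about the rest of the memory,
  unlike \<open>input_state\<close>. No part of the program assigns these cells, so it is an
  invariant of the whole run.\<close>

definition input :: "nat list list \<Rightarrow> nat \<Rightarrow> state \<Rightarrow> bool" where
  "input ns k s \<longleftrightarrow> fst s ''n'' = length ns \<and> fst s ''k'' = k \<and>
     (\<forall>v\<le>length ns. snd s ''off'' v = offset ns v) \<and>
     (\<forall>v<length ns. \<forall>j<length (ns ! v). snd s ''adj'' (offset ns v + j) = ns ! v ! j)"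

lemma input_cong:
  assumes "input ns k s" "fst s' ''n'' = fst s ''n''" "fst s' ''k'' = fst s ''k''"
    "snd s' ''off'' = snd s ''off''" "snd s' ''adj'' = snd s ''adj''"
  shows "input ns k s'"
  using assms by (simp add: input_def)

lemma input_input_state: "input ns k (input_state ns k)"
proof -
  have "offset ns v + j < length (concat ns)" if "v < length ns" "j < length (ns ! v)" for v j
  proof -
    have "offset ns v + j < offset ns (Suc v)"
      using that by (simp add: offset_Suc)
    also have "\<dots> \<le> offset ns (length ns)"
      using that by (intro offset_mono) auto
    finally show ?thesis
      by (simp add: offset_def)
  qed
  then show ?thesis
    by (auto simp: input_def input_state_def array_of_def nth_concat_offset offset_def[symmetric]
        simp del: upt_Suc)
qed

text \<open>\<open>degen\<close> always takes its graph from \<open>V\<close>, \<open>S\<close>,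
  \<open>L\<close> and \<open>A\<close>. Bringing the input into this format lets the same program
  serve the whole graph and the induced subgraphs, while \<open>off\<close> and \<open>adj\<close>
  survive when those arrays are overwritten.\<close>

definition load :: com where
  "load =
     For ''v'' (Reg ''n'')
       (Store ''V'' (Reg ''v'') (Reg ''v'') ;;
        Store ''S'' (Reg ''v'') (Get ''off'' (Reg ''v'')) ;;
        Store ''L'' (Reg ''v'')
          (Sub (Get ''off'' (Add (Reg ''v'') (Num 1))) (Get ''off'' (Reg ''v'')))) ;;
     Assign ''nv'' (Reg ''n'') ;;
     For ''j'' (Get ''off'' (Reg ''n'')) (Store ''A'' (Reg ''j'') (Get ''adj'' (Reg ''j'')))"

lemma mod_load:
  "mod_regs load = {''v'', ''nv'', ''j''}" "mod_arrays load = {''V'', ''S'', ''L'', ''A''}"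
  by (auto simp: load_def)

lemma wp_load:
  assumes inp: "input ns k s"
  shows "wp load (\<lambda>t s'. fst s' ''nv'' = length ns \<and>
      (\<forall>v<length ns. snd s' ''V'' v = v \<and> snd s' ''L'' v = length (ns ! v) \<and>
        (\<forall>j<length (ns ! v). snd s' ''A'' (snd s' ''S'' v + j) = ns ! v ! j)) \<and>
      t \<le> 50 * length ns + 50 * length (concat ns) + 50) s"
proof -
  let ?n = "length ns" and ?off = "snd s ''off''" and ?adj = "snd s ''adj''"
  have inp': "fst s ''n'' = ?n" "\<And>v. v \<le> ?n \<Longrightarrow> ?off v = offset ns v"
    "\<And>v j. v < ?n \<Longrightarrow> j < length (ns ! v) \<Longrightarrow> ?adj (offset ns v + j) = ns ! v ! j"
    using inp by (auto simp: input_def)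
  have len: "?off ?n = length (concat ns)"
    using inp' by (simp add: offset_def)
  define P where "P = (\<lambda>i (s'::state). \<forall>v<i. snd s' ''V'' v = v \<and> snd s' ''S'' v = offset ns v \<and>
      snd s' ''L'' v = length (ns ! v))"
  have 1: "wp (For ''v'' (Reg ''n'')
       (Store ''V'' (Reg ''v'') (Reg ''v'') ;;
        Store ''S'' (Reg ''v'') (Get ''off'' (Reg ''v'')) ;;
        Store ''L'' (Reg ''v'')
          (Sub (Get ''off'' (Add (Reg ''v'') (Num 1))) (Get ''off'' (Reg ''v'')))))
     (\<lambda>t s'. P ?n s' \<and> t \<le> 50 * ?n + 10) s"
    by (rule wp_For[where N = ?n and M = "50 * ?n" and
          I = "\<lambda>i t s'. fst s' ''n'' = ?n \<and> snd s' ''off'' = ?off \<and> P i s' \<and> t \<le> 50 * i"])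
      (auto simp: P_def inp' less_Suc_eq offset_Suc)
  have 2: "wp (For ''j'' (Get ''off'' (Reg ''n'')) (Store ''A'' (Reg ''j'') (Get ''adj'' (Reg ''j''))))
     (\<lambda>t s'. (\<forall>j<length (concat ns). snd s' ''A'' j = ?adj j) \<and> t \<le> 50 * length (concat ns) + 10) s'"
    if "fst s' ''n'' = ?n" "snd s' ''off'' = ?off" "snd s' ''adj'' = ?adj" for s' :: state
    by (rule wp_For[where N = "length (concat ns)" and M = "50 * length (concat ns)" and
          I = "\<lambda>i t s'. fst s' ''n'' = ?n \<and> snd s' ''off'' = ?off \<and> snd s' ''adj'' = ?adj \<and>
            (\<forall>j<i. snd s' ''A'' j = ?adj j) \<and> t \<le> 50 * i"])
      (use that in \<open>auto simp: less_Suc_eq len\<close>)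
  have lt: "offset ns v + j < length (concat ns)" if "v < ?n" "j < length (ns ! v)" for v j
  proof -
    have "offset ns v + j < offset ns (Suc v)"
      using that by (simp add: offset_Suc)
    also have "\<dots> \<le> offset ns ?n"
      using that by (intro offset_mono) auto
    finally show ?thesis
      by (simp add: offset_def)
  qed
  show ?thesis
    unfolding load_def wp_Seq[where P = "For x y z" for x y z]
      wp_Seq[where P = "Assign x y" for x y] wp_Assign
  proof (rule wp_conseq_frame[OF 1], rule wp_conseq_frame[OF 2])
    fix t1 t2 and s1 s2 :: state
    assume 1: "P ?n s1 \<and> t1 \<le> 50 * ?n + 10"
      and 2: "(\<forall>j<length (concat ns). snd s2 ''A'' j = ?adj j) \<and> t2 \<le> 50 * length (concat ns) + 10"
      and "\<And>x. x \<notin> mod_regs (For ''j'' (Get ''off'' (Reg ''n''))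
          (Store ''A'' (Reg ''j'') (Get ''adj'' (Reg ''j'')))) \<Longrightarrow>
          fst s2 x = fst ((fst s1)(''nv'' := aval (Reg ''n'') s1), snd s1) x"
        "\<And>X. X \<notin> mod_arrays (For ''j'' (Get ''off'' (Reg ''n''))
          (Store ''A'' (Reg ''j'') (Get ''adj'' (Reg ''j'')))) \<Longrightarrow>
          snd s2 X = snd ((fst s1)(''nv'' := aval (Reg ''n'') s1), snd s1) X"
      and "\<And>x. x \<notin> mod_regs (For ''v'' (Reg ''n'')
          (Store ''V'' (Reg ''v'') (Reg ''v'') ;;
           Store ''S'' (Reg ''v'') (Get ''off'' (Reg ''v'')) ;;
           Store ''L'' (Reg ''v'')
             (Sub (Get ''off'' (Add (Reg ''v'') (Num 1))) (Get ''off'' (Reg ''v''))))) \<Longrightarrow>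
          fst s1 x = fst s x"
    then have "fst s2 ''nv'' = ?n" "snd s2 ''V'' = snd s1 ''V''" "snd s2 ''S'' = snd s1 ''S''"
      "snd s2 ''L'' = snd s1 ''L''"
      by (simp_all add: inp')
    then show "fst s2 ''nv'' = ?n \<and>
      (\<forall>v<?n. snd s2 ''V'' v = v \<and> snd s2 ''L'' v = length (ns ! v) \<and>
        (\<forall>j<length (ns ! v). snd s2 ''A'' (snd s2 ''S'' v + j) = ns ! v ! j)) \<and>
      t1 + (1 + acost (Reg ''n'') + t2) \<le> 50 * ?n + 50 * length (concat ns) + 50"
      using 1 2 lt inp'(3) by (simp add: P_def)
  qed (simp_all add: inp')
qed

text \<open>The shift \<open>c\<close> is 0 for the initial solution and 1 when cell 0 is taken by
  \<open>u\<close>.\<close>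

definition copy :: "nat \<Rightarrow> com" where
  "copy c = For ''j'' (Sub (Reg ''nv'') (Reg ''b''))
     (Store ''out'' (Add (Reg ''j'') (Num c)) (Get ''O'' (Add (Reg ''b'') (Reg ''j''))))"

lemma mod_copy: "mod_regs (copy c) = {''j''}" "mod_arrays (copy c) = {''out''}"
  by (auto simp: copy_def)

lemma wp_copy:
  "wp (copy c) (\<lambda>t s'. (\<forall>j<fst s ''nv'' - fst s ''b''. snd s' ''out'' (j + c) = snd s ''O'' (fst s ''b'' + j)) \<and>
     (\<forall>j<c. snd s' ''out'' j = snd s ''out'' j) \<and> t \<le> 50 * fst s ''nv'' + 20) s"
  unfolding copy_def
  by (rule wp_For[where N = "fst s ''nv'' - fst s ''b''" and M = "50 * fst s ''nv''" and
        I = "\<lambda>i t s'. fst s' ''nv'' = fst s ''nv'' \<and> fst s' ''b'' = fst s ''b'' \<and>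
          snd s' ''O'' = snd s ''O'' \<and> (\<forall>j<i. snd s' ''out'' (j + c) = snd s ''O'' (fst s ''b'' + j)) \<and>
          (\<forall>j<c. snd s' ''out'' j = snd s ''out'' j) \<and> t \<le> 50 * i"])
    (auto simp: less_Suc_eq)

section \<open>Positions in the ordering and lists of later neighbors\<close>

definition positions :: com where
  "positions = For ''i'' (Reg ''nv'') (Store ''P'' (Get ''O'' (Reg ''i'')) (Reg ''i''))"

lemma mod_positions: "mod_regs positions = {''i''}" "mod_arrays positions = {''P''}"
  by (auto simp: positions_def)

lemma wp_positions:
  assumes "fst s ''nv'' = length os" "distinct os" "\<forall>j<length os. snd s ''O'' j = os ! j"
  shows "wp positions (\<lambda>t s'. (\<forall>j<length os. snd s' ''P'' (os ! j) = j) \<and> t \<le> 50 * length os + 20) s"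
  unfolding positions_def
  by (rule wp_For[where N = "length os" and M = "50 * length os" and
        I = "\<lambda>i t s'. fst s' ''nv'' = length os \<and> snd s' ''O'' = snd s ''O'' \<and> t \<le> 50 * i \<and>
          (\<forall>j<i. snd s' ''P'' (os ! j) = j)"])
    (use assms in \<open>auto simp: less_Suc_eq nth_eq_iff_index_eq\<close>)

lemma later_neighbors_nth:
  assumes "distinct vs" "i < length vs" "j < length vs"
  shows "vs ! j \<in> later_neighbors G vs (vs ! i) \<longleftrightarrow> vs ! j \<in> neighbors G (vs ! i) \<and> i < j"
  using assms by (auto simp: later_neighbors_def nth_eq_iff_index_eq)

lemma later_neighbors_asym:
  assumes "distinct vs" "w \<in> later_neighbors G vs v"
  shows "v \<notin> later_neighbors G vs w"
proof -
  obtain i j where "i < j" "j < length vs" "vs ! i = v" "vs ! j = w"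
    using assms(2) by (auto simp: later_neighbors_def)
  then show ?thesis
    using later_neighbors_nth[OF assms(1), of j i G] by auto
qed

lemma later_neighbors_total:
  assumes "simple_graph G" "distinct vs" "v \<in> set vs" "w \<in> set vs" "w \<in> neighbors G v"
  shows "w \<in> later_neighbors G vs v \<or> v \<in> later_neighbors G vs w"
proof -
  obtain i j where ij: "i < length vs" "j < length vs" "vs ! i = v" "vs ! j = w"
    using assms(3,4) by (metis in_set_conv_nth)
  then have "i \<noteq> j"
    using assms(5) neighbors_irrefl[OF assms(1)] by auto
  then show ?thesis
    using later_neighbors_nth[OF assms(2), of i j G] later_neighbors_nth[OF assms(2), of j i G] ij
      assms(5) neighbors_sym[of w G v] by auto
qed

text \<open>A filtered list is no longer than the adjacency list it comes from, so the rows of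
  \<open>Y\<close> can reuse the offsets of \<open>adj\<close>, and only their lengths
  \<open>C\<close> are new.\<close>

definition later_lists :: com where
  "later_lists = For ''u'' (Reg ''n'')
     (Assign ''c'' (Num 0) ;;
      For ''j'' (Sub (Get ''off'' (Add (Reg ''u'') (Num 1))) (Get ''off'' (Reg ''u'')))
        (Assign ''w'' (Get ''adj'' (Add (Get ''off'' (Reg ''u'')) (Reg ''j''))) ;;
         If (Less (Get ''P'' (Reg ''u'')) (Get ''P'' (Reg ''w'')))
           (Store ''Y'' (Add (Get ''off'' (Reg ''u'')) (Reg ''c'')) (Reg ''w'') ;;
            Assign ''c'' (Add (Reg ''c'') (Num 1)))
           Skip) ;;
      Store ''C'' (Reg ''u'') (Reg ''c''))"

lemma mod_later_lists:
  "mod_regs later_lists = {''u'', ''c'', ''j'', ''w''}" "mod_arrays later_lists = {''Y'', ''C''}"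
  by (auto simp: later_lists_def)

locale ordered_graph =
  fixes G :: "nat ugraph" and ns :: "nat list list" and k :: nat and os :: "nat list"
  assumes simple: "simple_graph G" and adjacency: "adjacency_lists G ns"
    and ordering: "degeneracy_ordering G os"
begin

text \<open>A filter of the given adjacency list rather than just any enumeration of the set, so
  that it agrees with the stored row entry by entry.\<close>

definition later :: "nat \<Rightarrow> nat list" where
  "later v = filter (\<lambda>w. w \<in> later_neighbors G os v) (ns ! v)"

lemma os: "distinct os" "set os = verts G" "length os = length ns"
proof -
  show "distinct os" "set os = verts G"
    using ordering by (auto simp: degeneracy_ordering_def)
  then show "length os = length ns"
    using adjacency unfolding adjacency_lists_def by (metis card_lessThan distinct_card)
qed

lemma verts: "verts G = {..<length ns}"
  using adjacency by (simp add: adjacency_lists_def)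

lemma later: "v < length ns \<Longrightarrow> distinct (later v)" "v < length ns \<Longrightarrow> set (later v) = later_neighbors G os v"
  using adjacency by (auto simp: adjacency_lists_def later_def later_neighbors_def)

lemma later_subset: "v < length ns \<Longrightarrow> set (later v) \<subseteq> verts G"
  using later(2) neighbors_subset[OF simple, of v] by (auto simp: later_neighbors_def)

lemma length_later_le: "v < length ns \<Longrightarrow> length (later v) \<le> degeneracy G"
  using card_later_neighbors_le[OF simple ordering, of v] later[of v] verts
  by (metis distinct_card lessThan_iff)

lemma length_later_le_length: "length (later v) \<le> length (ns ! v)"
  by (simp add: later_def)

lemma length_nth: "v < length ns \<Longrightarrow> length (ns ! v) = deg G v"
  using adjacency by (auto simp: adjacency_lists_def deg_def distinct_card[symmetric])

lemma length_concat: "length (concat ns) = (\<Sum>v\<in>verts G. deg G v)"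
proof -
  have "length (concat ns) = (\<Sum>v<length ns. length (ns ! v))"
    \<comment> \<open>Here \<open>length_concat\<close> is still the library fact about lists, as
      the lemma of that name is only being proved.\<close>
    by (simp add: length_concat sum_list_sum_nth atLeast0LessThan)
  then show ?thesis
    by (simp add: verts length_nth)
qed

definition later_stored :: "nat \<Rightarrow> state \<Rightarrow> bool" where
  "later_stored n s \<longleftrightarrow> (\<forall>v<n. snd s ''C'' v = length (later v) \<and>
     (\<forall>j<length (later v). snd s ''Y'' (offset ns v + j) = later v ! j))"

text \<open>The row of \<open>u\<close> is written from its offset upwards. Rows of smaller vertices
  lie entirely below and survive; those of larger vertices are not yet written.\<close>

lemma wp_later_list:
  assumes inp: "input ns k s" and u: "fst s ''u'' = u" "u < length ns" and c: "fst s ''c'' = 0"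
    and P: "\<forall>w\<in>set (ns ! u). snd s ''P'' u < snd s ''P'' w \<longleftrightarrow> w \<in> later_neighbors G os u"
  shows "wp (For ''j'' (Sub (Get ''off'' (Add (Reg ''u'') (Num 1))) (Get ''off'' (Reg ''u'')))
        (Assign ''w'' (Get ''adj'' (Add (Get ''off'' (Reg ''u'')) (Reg ''j''))) ;;
         If (Less (Get ''P'' (Reg ''u'')) (Get ''P'' (Reg ''w'')))
           (Store ''Y'' (Add (Get ''off'' (Reg ''u'')) (Reg ''c'')) (Reg ''w'') ;;
            Assign ''c'' (Add (Reg ''c'') (Num 1)))
           Skip))
     (\<lambda>t s'. fst s' ''c'' = length (later u) \<and>
        (\<forall>j<length (later u). snd s' ''Y'' (offset ns u + j) = later u ! j) \<and>
        (\<forall>x<offset ns u. snd s' ''Y'' x = snd s ''Y'' x) \<and> t \<le> 60 * length (ns ! u) + 20) s"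
proof -
  let ?l = "\<lambda>j. filter (\<lambda>w. w \<in> later_neighbors G os u) (take j (ns ! u))"
  have off: "snd s ''off'' u = offset ns u" "snd s ''off'' (Suc u) = offset ns u + length (ns ! u)"
    and adj: "\<And>j. j < length (ns ! u) \<Longrightarrow> snd s ''adj'' (offset ns u + j) = ns ! u ! j"
    using inp u by (auto simp: input_def offset_Suc)
  define I where "I = (\<lambda>j t (s'::state). fst s' ''u'' = u \<and> snd s' ''off'' = snd s ''off'' \<and>
     snd s' ''adj'' = snd s ''adj'' \<and> snd s' ''P'' = snd s ''P'' \<and> fst s' ''c'' = length (?l j) \<and>
     (\<forall>i<length (?l j). snd s' ''Y'' (offset ns u + i) = ?l j ! i) \<and>
     (\<forall>x<offset ns u. snd s' ''Y'' x = snd s ''Y'' x) \<and> t \<le> 60 * j)"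
  show ?thesis
  proof (rule wp_For[where I = I and N = "length (ns ! u)" and M = "60 * length (ns ! u)"])
    fix i t and s' :: state
    assume I: "I i t s'" and i: "fst s' ''j'' = i" "i < length (ns ! u)"
    let ?w = "ns ! u ! i"
    have tk: "?l (Suc i) = ?l i @ (if ?w \<in> later_neighbors G os u then [?w] else [])"
      using i(2) by (simp add: take_Suc_conv_app_nth)
    have P': "snd s ''P'' u < snd s ''P'' ?w \<longleftrightarrow> ?w \<in> later_neighbors G os u"
      using P i(2) by simp
    show "wp (Assign ''w'' (Get ''adj'' (Add (Get ''off'' (Reg ''u'')) (Reg ''j''))) ;;
         If (Less (Get ''P'' (Reg ''u'')) (Get ''P'' (Reg ''w'')))
           (Store ''Y'' (Add (Get ''off'' (Reg ''u'')) (Reg ''c'')) (Reg ''w'') ;;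
            Assign ''c'' (Add (Reg ''c'') (Num 1)))
           Skip)
       (\<lambda>v s'. I (Suc i) (7 + acost (Sub (Get ''off'' (Add (Reg ''u'') (Num 1))) (Get ''off'' (Reg ''u''))) + t + v)
          ((fst s')(''j'' := Suc i), snd s')) s'"
      using I unfolding I_def tk
      by (cases "?w \<in> later_neighbors G os u")
        (simp_all add: off adj[OF i(2)] i(1) P' nth_append less_Suc_eq)
  qed (auto simp: I_def u c off later_def)
qed

lemma wp_later_lists:
  assumes inp: "input ns k s" and P: "\<forall>j<length os. snd s ''P'' (os ! j) = j"
  shows "wp later_lists (\<lambda>t s'. later_stored (length ns) s' \<and>
    t \<le> 60 * length ns + 60 * length (concat ns) + 20) s"
proof -
  have P_iff: "\<forall>w\<in>set (ns ! u). snd s ''P'' u < snd s ''P'' w \<longleftrightarrow> w \<in> later_neighbors G os u"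
    if u: "u < length ns" for u
  proof
    fix w assume w: "w \<in> set (ns ! u)"
    then have nb: "w \<in> neighbors G u"
      using adjacency u by (auto simp: adjacency_lists_def)
    then have "w \<in> verts G"
      using neighbors_subset[OF simple] by blast
    then obtain i j where "i < length os" "j < length os" "os ! i = u" "os ! j = w"
      using os(2) verts u by (metis in_set_conv_nth lessThan_iff)
    then show "snd s ''P'' u < snd s ''P'' w \<longleftrightarrow> w \<in> later_neighbors G os u"
      using later_neighbors_nth[OF os(1), of i j G] P nb by auto
  qed
  \<comment> \<open>The term \<open>60 * offset ns u\<close> telescopes to 60 per entry of the
    adjacency lists.\<close>
  define I where "I = (\<lambda>u t (s'::state). input ns k s' \<and> snd s' ''P'' = snd s ''P'' \<and>
     later_stored u s' \<and> t \<le> 60 * u + 60 * offset ns u)"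
  show ?thesis
    unfolding later_lists_def
  proof (rule wp_For[where I = I and N = "length ns" and
        M = "60 * length ns + 60 * offset ns (length ns)"])
    have "input ns k ((fst s)(''u'' := 0), snd s)"
      by (rule input_cong[OF inp]) auto
    then show "I 0 0 ((fst s)(''u'' := 0), snd s)"
      by (simp add: I_def later_stored_def)
  next
    fix u t and s' :: state
    assume I: "I u t s'" and u: "fst s' ''u'' = u" "u < length ns"
    let ?s = "((fst s')(''c'' := 0), snd s')"
    have inp': "input ns k ?s"
      by (rule input_cong[of ns k s']) (use I in \<open>auto simp: I_def\<close>)
    show "wp (Assign ''c'' (Num 0) ;;
      For ''j'' (Sub (Get ''off'' (Add (Reg ''u'') (Num 1))) (Get ''off'' (Reg ''u'')))
        (Assign ''w'' (Get ''adj'' (Add (Get ''off'' (Reg ''u'')) (Reg ''j''))) ;;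
         If (Less (Get ''P'' (Reg ''u'')) (Get ''P'' (Reg ''w'')))
           (Store ''Y'' (Add (Get ''off'' (Reg ''u'')) (Reg ''c'')) (Reg ''w'') ;;
            Assign ''c'' (Add (Reg ''c'') (Num 1)))
           Skip) ;;
      Store ''C'' (Reg ''u'') (Reg ''c''))
      (\<lambda>v s'. I (Suc u) (7 + acost (Reg ''n'') + t + v) ((fst s')(''u'' := Suc u), snd s')) s'"
      unfolding wp_Seq[where P = "Assign ''c'' (Num 0)"] wp_Seq[where P = "For x y z" for x y z]
        wp_Assign wp_Store aval.simps
    proof (rule wp_conseq_frame[OF wp_later_list[where u = u]])
      show "input ns k ?s" by (rule inp')
      show "\<forall>w\<in>set (ns ! u). snd ?s ''P'' u < snd ?s ''P'' w \<longleftrightarrow> w \<in> later_neighbors G os u"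
        using P_iff[OF u(2)] I by (simp add: I_def)
    next
      fix t2 and s2 :: state
      assume post: "fst s2 ''c'' = length (later u) \<and>
        (\<forall>j<length (later u). snd s2 ''Y'' (offset ns u + j) = later u ! j) \<and>
        (\<forall>x<offset ns u. snd s2 ''Y'' x = snd ?s ''Y'' x) \<and> t2 \<le> 60 * length (ns ! u) + 20"
        and regs: "\<And>x. x \<notin> mod_regs (For ''j'' (Sub (Get ''off'' (Add (Reg ''u'') (Num 1))) (Get ''off'' (Reg ''u'')))
        (Assign ''w'' (Get ''adj'' (Add (Get ''off'' (Reg ''u'')) (Reg ''j''))) ;;
         If (Less (Get ''P'' (Reg ''u'')) (Get ''P'' (Reg ''w'')))
           (Store ''Y'' (Add (Get ''off'' (Reg ''u'')) (Reg ''c'')) (Reg ''w'') ;;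
            Assign ''c'' (Add (Reg ''c'') (Num 1)))
           Skip)) \<Longrightarrow> fst s2 x = fst ?s x"
        and arrays: "\<And>X. X \<notin> mod_arrays (For ''j'' (Sub (Get ''off'' (Add (Reg ''u'') (Num 1))) (Get ''off'' (Reg ''u'')))
        (Assign ''w'' (Get ''adj'' (Add (Get ''off'' (Reg ''u'')) (Reg ''j''))) ;;
         If (Less (Get ''P'' (Reg ''u'')) (Get ''P'' (Reg ''w'')))
           (Store ''Y'' (Add (Get ''off'' (Reg ''u'')) (Reg ''c'')) (Reg ''w'') ;;
            Assign ''c'' (Add (Reg ''c'') (Num 1)))
           Skip)) \<Longrightarrow> snd s2 X = snd ?s X"
      have fr: "fst s2 ''u'' = u" "snd s2 ''P'' = snd s' ''P''" "snd s2 ''C'' = snd s' ''C''"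
        by (simp_all add: regs arrays u)
      let ?s3 = "((fst s2)(''u'' := Suc u), (snd s2)(''C'' := (snd s2 ''C'')(u := length (later u))))"
      have "input ns k ?s3"
        by (rule input_cong[OF inp']) (simp_all add: regs arrays)
      moreover have "later_stored (Suc u) ?s3"
        unfolding later_stored_def
      proof (intro allI impI)
        fix v assume v: "v < Suc u"
        show "snd ?s3 ''C'' v = length (later v) \<and>
          (\<forall>j<length (later v). snd ?s3 ''Y'' (offset ns v + j) = later v ! j)"
        proof (cases "v = u")
          case True
          then show ?thesis using post by simp
        next
          case False
          then have vu: "v < u" using v by simp
          have "offset ns v + j < offset ns u" if "j < length (later v)" for j
          proof -
            have "offset ns v + j < offset ns (Suc v)"
              using that vu u(2) length_later_le_length[of v] by (simp add: offset_Suc)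
            also have "\<dots> \<le> offset ns u"
              using vu u(2) by (intro offset_mono) auto
            finally show ?thesis .
          qed
          then show ?thesis
            using post I vu by (simp add: I_def later_stored_def fr)
        qed
      qed
      ultimately have "I (Suc u) (7 + acost (Reg ''n'') + t + (1 + acost (Num 0) +
          (t2 + (1 + acost (Reg ''u'') + acost (Reg ''c''))))) ?s3"
        using I post u by (simp add: I_def fr offset_Suc)
      then show "I (Suc u) (7 + acost (Reg ''n'') + t + (1 + acost (Num 0) +
          (t2 + (1 + acost (Reg ''u'') + acost (Reg ''c'')))))
        ((fst (fst s2, (snd s2)(''C'' := (snd s2 ''C'')(fst s2 ''u'' := fst s2 ''c''))))(''u'' := Suc u),
          snd (fst s2, (snd s2)(''C'' := (snd s2 ''C'')(fst s2 ''u'' := fst s2 ''c''))))"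
        using post by (simp add: fr)
    qed (simp_all add: u)
  next
    fix t and s' :: state
    assume "I (length ns) t s'"
    then show "later_stored (length ns) s' \<and>
        5 + acost (Reg ''n'') + t \<le> 60 * length ns + 60 * length (concat ns) + 20"
      by (simp add: I_def offset_def)
  next
    fix i t and s' :: state
    assume I: "I i t s'" "i \<le> length ns"
    then show "t \<le> 60 * length ns + 60 * offset ns (length ns)"
      using offset_mono[OF I(2), of ns] by (simp add: I_def)
  qed (auto simp: I_def input_def)
qed

end

section \<open>The subgraphs induced by later neighbors\<close>

text \<open>Adjacency lists under construction: \<open>R\<close> contains the ordered pairs treated
  so far. Only pairs within \<open>vs\<close> matter, so pairs leading outside may be added to
  \<open>R\<close> without touching memory.\<close>

definition adj_lists_of :: "nat list \<Rightarrow> (nat \<times> nat) set \<Rightarrow> (nat \<Rightarrow> nat) \<Rightarrow> (nat \<Rightarrow> nat) \<Rightarrow> (nat \<Rightarrow> nat) \<Rightarrow>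
    (nat \<Rightarrow> nat list) \<Rightarrow> bool" where
  "adj_lists_of vs R st l a F \<longleftrightarrow>
     (\<forall>x\<in>set vs. distinct (F x) \<and> set (F x) = {y \<in> set vs. (x, y) \<in> R} \<and> l x = length (F x) \<and>
        (\<forall>t<length (F x). a (st x + t) = F x ! t))"

text \<open>As \<open>R\<close> is irreflexive, a list has fewer than \<open>length vs\<close>
  entries, so a row of that length has room for another one. Dividing a position by
  \<open>length vs\<close> recovers its row, hence the new cell belongs to no other list.\<close>

lemma adj_lists_of_add:
  assumes F: "adj_lists_of vs R st l a F" and vs: "distinct vs" "\<forall>i<length vs. st (vs ! i) = i * length vs"
    and R: "irrefl R" and xy: "x \<in> set vs" "y \<in> set vs" "x \<noteq> y" "(x, y) \<notin> R"
  shows "adj_lists_of vs (insert (x, y) R) st (l(x := Suc (l x))) (a(st x + l x := y))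
    (F(x := F x @ [y]))"
proof -
  have len: "length (F z) < length vs" if "z \<in> set vs" for z
  proof -
    have "set (F z) \<subset> set vs"
      using F R that by (auto simp: adj_lists_of_def irrefl_def)
    then have "card (set (F z)) < card (set vs)"
      by (simp add: psubset_card_mono)
    moreover have "distinct (F z)"
      using F that by (simp add: adj_lists_of_def)
    ultimately show ?thesis
      using vs(1) by (simp only: distinct_card)
  qed
  have lx: "l x = length (F x)"
    using F xy(1) by (simp add: adj_lists_of_def)
  have sep: "z = x \<and> t = length (F x)"
    if z: "z \<in> set vs" and t: "t < length vs" and eq: "st z + t = st x + length (F x)" for z t
  proof -
    obtain i j where ij: "i < length vs" "j < length vs" "vs ! i = z" "vs ! j = x"
      using z xy(1) by (metis in_set_conv_nth)
    then have *: "i * length vs + t = j * length vs + length (F x)"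
      using eq vs(2) by metis
    then have "(i * length vs + t) div length vs = (j * length vs + length (F x)) div length vs"
      by simp
    moreover have "(q * length vs + r) div length vs = q" if "r < length vs" for q r
      using that by (metis add.right_neutral div_less div_mult_self3 not_less_zero)
    ultimately have "i = j"
      using t len[OF xy(1)] by metis
    then show ?thesis
      using * ij by simp
  qed
  show ?thesis
    unfolding adj_lists_of_def
  proof
    fix z assume z: "z \<in> set vs"
    show "distinct ((F(x := F x @ [y])) z) \<and>
      set ((F(x := F x @ [y])) z) = {y' \<in> set vs. (z, y') \<in> insert (x, y) R} \<and>
      (l(x := Suc (l x))) z = length ((F(x := F x @ [y])) z) \<and>
      (\<forall>t<length ((F(x := F x @ [y])) z).
        (a(st x + l x := y)) (st z + t) = (F(x := F x @ [y])) z ! t)"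
    proof (cases "z = x")
      case True
      then show ?thesis
        using F z xy lx by (auto simp: adj_lists_of_def nth_append less_Suc_eq)
    next
      case False
      have "a (st z + t) = F z ! t \<and> st z + t \<noteq> st x + l x" if "t < length (F z)" for t
        using sep[OF z, of t] that len[OF z] False F z lx by (auto simp: adj_lists_of_def)
      then show ?thesis
        using False F z by (auto simp: adj_lists_of_def)
    qed
  qed
qed

text \<open>The adjacency list of the \<open>i\<close>-th of the \<open>nv\<close> vertices of \<open>g\<close> gets the positions from \<open>i * nv\<close> on
  (\<open>z\<close> holds this product). \<open>M[w] = u + 1\<close> marks \<open>w\<close> as a vertex of \<open>g\<close>; marks set for earlier \<open>u\<close> are
  smaller and need not be cleared.\<close>

definition local_vertices :: com where
  "local_vertices =
     Assign ''nv'' (Get ''C'' (Reg ''u'')) ;; Assign ''z'' (Num 0) ;;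
     For ''i'' (Reg ''nv'')
       (Assign ''v'' (Get ''Y'' (Add (Get ''off'' (Reg ''u'')) (Reg ''i''))) ;;
        Store ''V'' (Reg ''i'') (Reg ''v'') ;;
        Store ''S'' (Reg ''v'') (Reg ''z'') ;;
        Store ''L'' (Reg ''v'') (Num 0) ;;
        Store ''M'' (Reg ''v'') (Add (Reg ''u'') (Num 1)) ;;
        Assign ''z'' (Add (Reg ''z'') (Reg ''nv'')))"

lemma mod_local_vertices:
  "mod_regs local_vertices = {''nv'', ''z'', ''i'', ''v''}"
  "mod_arrays local_vertices = {''V'', ''S'', ''L'', ''M''}"
  by (auto simp: local_vertices_def)

text \<open>An edge of the subgraph is met only at its earlier end, hence both directions are
  entered at once. Marks never exceed \<open>u + 1\<close>, so the comparison with \<open>u\<close>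
  singles out the marks of the current subgraph.\<close>

definition local_edge_list :: com where
  "local_edge_list = For ''j'' (Get ''C'' (Reg ''v''))
     (Assign ''w'' (Get ''Y'' (Add (Get ''off'' (Reg ''v'')) (Reg ''j''))) ;;
      If (Less (Reg ''u'') (Get ''M'' (Reg ''w'')))
        (Store ''A'' (Add (Get ''S'' (Reg ''v'')) (Get ''L'' (Reg ''v''))) (Reg ''w'') ;;
         Store ''L'' (Reg ''v'') (Add (Get ''L'' (Reg ''v'')) (Num 1)) ;;
         Store ''A'' (Add (Get ''S'' (Reg ''w'')) (Get ''L'' (Reg ''w''))) (Reg ''v'') ;;
         Store ''L'' (Reg ''w'') (Add (Get ''L'' (Reg ''w'')) (Num 1)))
        Skip)"

lemma mod_local_edge_list:
  "mod_regs local_edge_list = {''j'', ''w''}" "mod_arrays local_edge_list = {''A'', ''L''}"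
  by (auto simp: local_edge_list_def)

definition local_edges :: com where
  "local_edges = For ''i'' (Reg ''nv'') (Assign ''v'' (Get ''V'' (Reg ''i'')) ;; local_edge_list)"

lemma mod_local_edges:
  "mod_regs local_edges = {''i'', ''v'', ''j'', ''w''}" "mod_arrays local_edges = {''A'', ''L''}"
  by (auto simp: local_edges_def mod_local_edge_list)

context ordered_graph
begin

lemma wp_local_vertices:
  assumes inp: "input ns k s" and st: "later_stored (length ns) s"
    and u: "fst s ''u'' = u" "u < length ns" and M: "\<forall>w. snd s ''M'' w \<le> u"
  shows "wp local_vertices (\<lambda>t s'. fst s' ''nv'' = length (later u) \<and>
      (\<forall>i<length (later u). snd s' ''V'' i = later u ! i \<and>
        snd s' ''S'' (later u ! i) = i * length (later u) \<and> snd s' ''L'' (later u ! i) = 0) \<and>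
      (\<forall>w. snd s' ''M'' w \<le> Suc u \<and> (u < snd s' ''M'' w \<longleftrightarrow> w \<in> set (later u))) \<and>
      t \<le> 60 * length (later u) + 20) s"
proof -
  let ?vs = "later u"
  have C: "snd s ''C'' u = length ?vs" "snd s ''off'' u = offset ns u"
    "\<And>j. j < length ?vs \<Longrightarrow> snd s ''Y'' (offset ns u + j) = ?vs ! j"
    using st inp u by (auto simp: later_stored_def input_def)
  have d: "?vs ! i = ?vs ! j \<longleftrightarrow> i = j" if "i < length ?vs" "j < length ?vs" for i j
    using later(1)[OF u(2)] that by (simp add: nth_eq_iff_index_eq)
  define I where "I = (\<lambda>i t (s'::state). fst s' ''nv'' = length ?vs \<and> fst s' ''u'' = u \<and>
     snd s' ''off'' = snd s ''off'' \<and> snd s' ''Y'' = snd s ''Y'' \<and> fst s' ''z'' = i * length ?vs \<and>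
     (\<forall>j<i. snd s' ''V'' j = ?vs ! j \<and> snd s' ''S'' (?vs ! j) = j * length ?vs \<and>
        snd s' ''L'' (?vs ! j) = 0) \<and>
     (\<forall>w. snd s' ''M'' w \<le> Suc u \<and> (u < snd s' ''M'' w \<longleftrightarrow> w \<in> set (take i ?vs))) \<and> t \<le> 60 * i)"
  show ?thesis
    unfolding local_vertices_def wp_Seq[where P = "Assign x y" for x y] wp_Assign
  proof (rule wp_For[where I = I and N = "length ?vs" and M = "60 * length ?vs"])
    fix i t and s' :: state
    assume I: "I i t s'" and i: "fst s' ''i'' = i" "i < length ?vs"
    have tk: "set (take (Suc i) ?vs) = insert (?vs ! i) (set (take i ?vs))"
      using i(2) by (simp add: take_Suc_conv_app_nth)
    have ne: "?vs ! j \<noteq> ?vs ! i" if "j < i" for j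
      using d[of j i] that i(2) by simp
    show "wp (Assign ''v'' (Get ''Y'' (Add (Get ''off'' (Reg ''u'')) (Reg ''i''))) ;;
        Store ''V'' (Reg ''i'') (Reg ''v'') ;;
        Store ''S'' (Reg ''v'') (Reg ''z'') ;;
        Store ''L'' (Reg ''v'') (Num 0) ;;
        Store ''M'' (Reg ''v'') (Add (Reg ''u'') (Num 1)) ;;
        Assign ''z'' (Add (Reg ''z'') (Reg ''nv'')))
      (\<lambda>v s'. I (Suc i) (7 + acost (Reg ''nv'') + t + v) ((fst s')(''i'' := Suc i), snd s')) s'"
      using I unfolding I_def tk
      by (simp add: C i ne less_Suc_eq)
  next
    show "I 0 0 ((fst ((fst ((fst s)(''nv'' := aval (Get ''C'' (Reg ''u'')) s), snd s))
        (''z'' := aval (Num 0) ((fst s)(''nv'' := aval (Get ''C'' (Reg ''u'')) s), snd s)),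
        snd ((fst s)(''nv'' := aval (Get ''C'' (Reg ''u'')) s), snd s)))(''i'' := 0),
        snd ((fst ((fst s)(''nv'' := aval (Get ''C'' (Reg ''u'')) s), snd s))
        (''z'' := aval (Num 0) ((fst s)(''nv'' := aval (Get ''C'' (Reg ''u'')) s), snd s)),
        snd ((fst s)(''nv'' := aval (Get ''C'' (Reg ''u'')) s), snd s)))"
      using M by (auto simp: I_def u C le_SucI not_less)
  qed (auto simp: I_def)
qed

lemma wp_local_edge_list:
  assumes inp: "input ns k s" and stored: "later_stored (length ns) s"
    and v: "fst s ''v'' = v" "v \<in> set vs" "v < length ns"
    and vs: "distinct vs" "\<forall>i<length vs. snd s ''S'' (vs ! i) = i * length vs"
    and M: "\<forall>w. fst s ''u'' < snd s ''M'' w \<longleftrightarrow> w \<in> set vs"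
    and R: "irrefl R" "\<forall>w\<in>set (later v). (v, w) \<notin> R \<and> (w, v) \<notin> R"
    and F: "adj_lists_of vs R (snd s ''S'') (snd s ''L'') (snd s ''A'') F"
  shows "wp local_edge_list (\<lambda>t s'.
      (\<exists>F. adj_lists_of vs (R \<union> {v} \<times> set (later v) \<union> set (later v) \<times> {v})
        (snd s ''S'') (snd s' ''L'') (snd s' ''A'') F) \<and> t \<le> 60 * length (later v) + 20) s"
proof -
  let ?S = "snd s ''S''"
  have C: "snd s ''C'' v = length (later v)" "snd s ''off'' v = offset ns v"
    "\<And>j. j < length (later v) \<Longrightarrow> snd s ''Y'' (offset ns v + j) = later v ! j"
    using stored inp v by (auto simp: later_stored_def input_def)
  let ?R = "\<lambda>j. R \<union> {v} \<times> set (take j (later v)) \<union> set (take j (later v)) \<times> {v}"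
  have irr: "v \<notin> set (later v)"
    using later(2)[OF v(3)] later_neighbors_asym[OF os(1), of v G v] by auto
  define I where "I = (\<lambda>j t (s'::state). fst s' ''v'' = v \<and> fst s' ''u'' = fst s ''u'' \<and>
     snd s' ''off'' = snd s ''off'' \<and> snd s' ''Y'' = snd s ''Y'' \<and> snd s' ''C'' = snd s ''C'' \<and>
     snd s' ''M'' = snd s ''M'' \<and> snd s' ''S'' = ?S \<and>
     (\<exists>F. adj_lists_of vs (?R j) ?S (snd s' ''L'') (snd s' ''A'') F) \<and> t \<le> 60 * j)"
  show ?thesis
    unfolding local_edge_list_def
  proof (rule wp_For[where I = I and N = "length (later v)" and M = "60 * length (later v)"])
    show "I 0 0 ((fst s)(''j'' := 0), snd s)"
      using F v(1) by (auto simp: I_def)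
  next
    fix j t and s' :: state
    assume I: "I j t s'" and j: "fst s' ''j'' = j" "j < length (later v)"
    let ?w = "later v ! j" and ?L = "snd s' ''L''" and ?A = "snd s' ''A''"
    obtain F' where F': "adj_lists_of vs (?R j) ?S ?L ?A F'"
      using I by (auto simp: I_def)
    have same: "fst s' ''v'' = v" "fst s' ''u'' = fst s ''u''" "snd s' ''off'' = snd s ''off''"
      "snd s' ''Y'' = snd s ''Y''" "snd s' ''C'' = snd s ''C''" "snd s' ''M'' = snd s ''M''"
      "snd s' ''S'' = ?S" "t \<le> 60 * j"
      using I by (simp_all add: I_def)
    have RS: "?R (Suc j) = insert (?w, v) (insert (v, ?w) (?R j))"
      using j(2) by (auto simp: take_Suc_conv_app_nth)
    have nw: "?w \<notin> set (take j (later v))" "?w \<noteq> v" "?w \<in> set (later v)"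
      using later(1)[OF v(3)] j(2) irr by (auto simp: in_set_conv_nth nth_eq_iff_index_eq)
    have irrR: "irrefl (?R j)" "irrefl (insert (v, ?w) (?R j))"
      using R(1) irr nw(2) by (auto simp: irrefl_def dest: in_set_takeD)
    have new: "(v, ?w) \<notin> ?R j" "(?w, v) \<notin> insert (v, ?w) (?R j)"
      using R(2) nw irr by (auto dest: in_set_takeD)
    show "wp (Assign ''w'' (Get ''Y'' (Add (Get ''off'' (Reg ''v'')) (Reg ''j''))) ;;
      If (Less (Reg ''u'') (Get ''M'' (Reg ''w'')))
        (Store ''A'' (Add (Get ''S'' (Reg ''v'')) (Get ''L'' (Reg ''v''))) (Reg ''w'') ;;
         Store ''L'' (Reg ''v'') (Add (Get ''L'' (Reg ''v'')) (Num 1)) ;;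
         Store ''A'' (Add (Get ''S'' (Reg ''w'')) (Get ''L'' (Reg ''w''))) (Reg ''v'') ;;
         Store ''L'' (Reg ''w'') (Add (Get ''L'' (Reg ''w'')) (Num 1)))
        Skip)
      (\<lambda>x s'. I (Suc j) (7 + acost (Get ''C'' (Reg ''v'')) + t + x) ((fst s')(''j'' := Suc j), snd s')) s'"
    proof (cases "?w \<in> set vs")
      case True
      \<comment> \<open>Two insertions, one per direction. As \<open>?w\<close> differs from
        \<open>v\<close>, the first leaves the length used by the second unchanged.\<close>
      from adj_lists_of_add[OF adj_lists_of_add[OF F' vs irrR(1) v(2) True nw(2)[symmetric] new(1)]
          vs irrR(2) True v(2) nw(2) new(2)] nw(2)
      have "\<exists>F. adj_lists_of vs (?R (Suc j)) ?S (?L(v := Suc (?L v), ?w := Suc (?L ?w)))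
        (?A(?S v + ?L v := ?w, ?S ?w + ?L ?w := v)) F"
        unfolding RS by auto
      then show ?thesis
        using True M same nw(2) unfolding I_def by (simp add: C j)
    next
      case False
      \<comment> \<open>Both new pairs involve a vertex outside \<open>vs\<close>, so no list
        changes.\<close>
      then have "adj_lists_of vs (?R (Suc j)) ?S ?L ?A F'"
        using F' unfolding RS adj_lists_of_def by auto
      then show ?thesis
        using False M same unfolding I_def by (simp add: C j) blast
    qed
  qed (auto simp: I_def C(1))
qed

text \<open>Of two adjacent vertices exactly one is a later neighbor of the other. Asymmetry ensures
  that no edge is entered twice, which keeps the lists distinct; totality ensures that none is
  missed. Each vertex scans at most \<delta>(G) later neighbors.\<close>

lemma wp_local_edges:
  assumes inp: "input ns k s" and stored: "later_stored (length ns) s"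
    and u: "u < length ns"
    and vs: "vs = later u" "fst s ''nv'' = length vs" "\<forall>i<length vs. snd s ''V'' i = vs ! i \<and>
        snd s ''S'' (vs ! i) = i * length vs \<and> snd s ''L'' (vs ! i) = 0"
    and M: "\<forall>w. fst s ''u'' < snd s ''M'' w \<longleftrightarrow> w \<in> set vs"
  shows "wp local_edges (\<lambda>t s'. (\<exists>F. stored_graph (induced G (set vs)) vs F s') \<and>
      t \<le> length vs * (60 * degeneracy G + 60) + 20) s"
proof -
  let ?S = "snd s ''S''" and ?\<delta> = "degeneracy G"
  have d: "distinct vs" "set vs \<subseteq> verts G"
    using later(1)[OF u] later_subset[OF u] vs(1) by auto
  have S: "\<forall>i<length vs. ?S (vs ! i) = i * length vs"
    using vs by simp
  \<comment> \<open>The pairs, in both directions, whose earlier end is among the first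
    \<open>i\<close> vertices of \<open>vs\<close>; the other end may lie outside
    \<open>vs\<close>.\<close>
  let ?R = "\<lambda>i. {(x, y). (x \<in> set (take i vs) \<and> y \<in> set (later x)) \<or>
    (y \<in> set (take i vs) \<and> x \<in> set (later y))}"
  have lt: "v < length ns" if "v \<in> set vs" for v
    using that d(2) verts by auto
  have asym: "x \<notin> set (later y)" if "y \<in> set (later x)" "x \<in> set vs" "y < length ns" for x y
    using later_neighbors_asym[OF os(1), of y G x] that later(2)[of x] later(2)[of y] lt[of x] by auto
  have irr: "x \<notin> set (later x)" if "x \<in> set vs" for x
    using asym[of x x] that lt by blast
  define I where "I = (\<lambda>i t (s'::state). input ns k s' \<and> later_stored (length ns) s' \<and>
     fst s' ''nv'' = length vs \<and> fst s' ''u'' = fst s ''u'' \<and> snd s' ''V'' = snd s ''V'' \<and>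
     snd s' ''M'' = snd s ''M'' \<and> snd s' ''S'' = ?S \<and>
     (\<exists>F. adj_lists_of vs (?R i) ?S (snd s' ''L'') (snd s' ''A'') F) \<and>
     t \<le> i * (60 * ?\<delta> + 60))"
  show ?thesis
    unfolding local_edges_def
  proof (rule wp_For[where I = I and N = "length vs" and M = "length vs * (60 * ?\<delta> + 60)"])
    have "input ns k ((fst s)(''i'' := 0), snd s)" "later_stored (length ns) ((fst s)(''i'' := 0), snd s)"
      using inp stored by (simp_all add: input_def later_stored_def)
    moreover have "adj_lists_of vs (?R 0) ?S (snd s ''L'') (snd s ''A'') (\<lambda>_. [])"
      using vs(3) by (auto simp: adj_lists_of_def in_set_conv_nth)
    ultimately show "I 0 0 ((fst s)(''i'' := 0), snd s)"
      using vs(2) unfolding I_def by auto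
  next
    fix i t and s1 :: state
    assume I: "I i t s1" and i: "fst s1 ''i'' = i" "i < length vs"
    let ?v = "vs ! i" and ?s = "((fst s1)(''v'' := vs ! i), snd s1)"
    obtain F where F: "adj_lists_of vs (?R i) ?S (snd s1 ''L'') (snd s1 ''A'') F"
      using I by (auto simp: I_def)
    have same: "fst s1 ''nv'' = length vs" "fst s1 ''u'' = fst s ''u''" "snd s1 ''V'' = snd s ''V''"
      "snd s1 ''M'' = snd s ''M''" "snd s1 ''S'' = ?S" "t \<le> i * (60 * ?\<delta> + 60)"
      using I by (simp_all add: I_def)
    have v: "?v \<in> set vs" "?v < length ns"
      using i(2) lt by auto
    have notin: "?v \<notin> set (take i vs)"
      using d(1) i(2) by (auto simp: in_set_conv_nth nth_eq_iff_index_eq)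
    have RS: "?R (Suc i) = ?R i \<union> {?v} \<times> set (later ?v) \<union> set (later ?v) \<times> {?v}"
      using i(2) by (auto simp: take_Suc_conv_app_nth)
    have inp1: "input ns k ?s" "later_stored (length ns) ?s"
      using I by (simp_all add: I_def input_def later_stored_def)
    have irrR: "irrefl (?R i)"
      using irr by (auto simp: irrefl_def dest: in_set_takeD)
    have new: "\<forall>w\<in>set (later ?v). (?v, w) \<notin> ?R i \<and> (w, ?v) \<notin> ?R i"
      using notin asym[OF _ v(1)] later_subset[OF v(2)] verts by (auto dest: in_set_takeD)
    have "wp local_edge_list (\<lambda>x s'. I (Suc i) (7 + acost (Reg ''nv'') + t + (3 + x))
        ((fst s')(''i'' := Suc i), snd s')) ?s"
    proof (rule wp_conseq_frame[OF wp_local_edge_list[where vs = vs and R = "?R i" and F = F, OF inp1 _ v]])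
      fix t2 and s2 :: state
      assume post: "(\<exists>F. adj_lists_of vs (?R i \<union> {?v} \<times> set (later ?v) \<union> set (later ?v) \<times> {?v})
          (snd ?s ''S'') (snd s2 ''L'') (snd s2 ''A'') F) \<and> t2 \<le> 60 * length (later ?v) + 20"
        and regs: "\<And>x. x \<notin> mod_regs local_edge_list \<Longrightarrow> fst s2 x = fst ?s x"
        and arrays: "\<And>X. X \<notin> mod_arrays local_edge_list \<Longrightarrow> snd s2 X = snd ?s X"
      have "input ns k ((fst s2)(''i'' := Suc i), snd s2)"
        by (rule input_cong[OF inp1(1)]) (simp_all add: regs arrays mod_local_edge_list)
      moreover have "later_stored (length ns) ((fst s2)(''i'' := Suc i), snd s2)"
        using inp1(2) by (simp add: later_stored_def arrays mod_local_edge_list)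
      moreover have "t2 \<le> 60 * ?\<delta> + 20"
        using post length_later_le[OF v(2)] by simp
      ultimately show "I (Suc i) (7 + acost (Reg ''nv'') + t + (3 + t2))
          ((fst s2)(''i'' := Suc i), snd s2)"
        using post same unfolding I_def RS by (simp add: regs arrays mod_local_edge_list)
    qed (use F S M d irrR new same in simp_all)
    then show "wp (Assign ''v'' (Get ''V'' (Reg ''i'')) ;; local_edge_list)
        (\<lambda>x s'. I (Suc i) (7 + acost (Reg ''nv'') + t + x) ((fst s')(''i'' := Suc i), snd s')) s1"
      using i same vs(3) by simp
  next
    fix t and s1 :: state
    assume I: "I (length vs) t s1"
    then obtain F where F: "adj_lists_of vs (?R (length vs)) ?S (snd s1 ''L'') (snd s1 ''A'') F"
      by (auto simp: I_def)
    have nb: "{y \<in> set vs. (x, y) \<in> ?R (length vs)} = neighbors (induced G (set vs)) x"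
      if x: "x \<in> set vs" for x
    proof -
      have "y \<in> set (later x) \<or> x \<in> set (later y) \<longleftrightarrow> y \<in> neighbors G x" if y: "y \<in> set vs" for y
      proof
        assume "y \<in> set (later x) \<or> x \<in> set (later y)"
        then show "y \<in> neighbors G x"
          using later(2)[OF lt[OF x]] later(2)[OF lt[OF y]] neighbors_sym[of x G y]
          by (auto simp: later_neighbors_def)
      next
        assume "y \<in> neighbors G x"
        moreover have "x \<in> set os" "y \<in> set os"
          using d(2) x y os(2) by auto
        ultimately show "y \<in> set (later x) \<or> x \<in> set (later y)"
          using later_neighbors_total[OF simple os(1)] later(2)[OF lt[OF x]] later(2)[OF lt[OF y]]
          by simp
      qed
      then show ?thesis
        using x by (auto simp: neighbors_induced)
    qed
    have "stored_graph (induced G (set vs)) vs F s1"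
      using F I vs d(1) nb unfolding stored_graph_def adj_lists_of_def I_def by simp
    then show "(\<exists>F. stored_graph (induced G (set vs)) vs F s1) \<and>
        5 + acost (Reg ''nv'') + t \<le> length vs * (60 * ?\<delta> + 60) + 20"
      using I by (auto simp: I_def)
  next
    fix i t and s1 :: state
    assume "I i t s1" "i \<le> length vs"
    then show "t \<le> length vs * (60 * ?\<delta> + 60)"
      unfolding I_def by (meson le_trans mult_le_mono1)
  qed (auto simp: I_def mod_local_edge_list)
qed

end

section \<open>The main loop\<close>

definition improve :: com where
  "improve = If (Less (Reg ''size'') (Add (Sub (Reg ''nv'') (Reg ''b'')) (Num 1)))
     (Assign ''size'' (Add (Sub (Reg ''nv'') (Reg ''b'')) (Num 1)) ;;
      Store ''out'' (Num 0) (Reg ''u'') ;; copy 1)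
     Skip"

lemma mod_improve: "mod_regs improve = {''size'', ''j''}" "mod_arrays improve = {''out''}"
  by (auto simp: improve_def mod_copy)

definition body :: com where
  "body = local_vertices ;; local_edges ;; degen ;; improve"

lemma mod_body:
  "mod_regs body = {''nv'', ''z'', ''i'', ''v'', ''j'', ''w'', ''e'', ''d'', ''f'', ''p'', ''b'', ''q'', ''size''}"
  "mod_arrays body = {''V'', ''S'', ''L'', ''M'', ''A'', ''H'', ''D'', ''a'', ''X'', ''N'', ''O'', ''R'', ''out''}"
  by (auto simp: body_def mod_local_vertices mod_local_edges mod_degen mod_improve)

definition degen_opt :: com where
  "degen_opt = load ;; degen ;; Assign ''size'' (Sub (Reg ''nv'') (Reg ''b'')) ;; copy 0 ;;
     positions ;; later_lists ;; For ''u'' (Reg ''n'') body"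

text \<open>The program compares lengths and the algorithm compares cardinalities. They agree
  because the output has no repetitions and \<open>u\<close> does not occur in the suffix.\<close>

lemma wp_improve:
  assumes nv: "fst s ''nv'' = length xs" and b: "fst s ''b'' \<le> length xs"
    and O: "\<forall>j<length xs. snd s ''O'' j = xs ! j" and u: "fst s ''u'' \<notin> set xs"
    and d: "distinct xs" "distinct (output_list s)"
  shows "wp improve (\<lambda>t s'. distinct (output_list s') \<and>
     set (output_list s') =
       (if card (set (drop (fst s ''b'') xs) \<union> {fst s ''u''}) > card (set (output_list s))
        then set (drop (fst s ''b'') xs) \<union> {fst s ''u''} else set (output_list s)) \<and>
     t \<le> 50 * length xs + 50) s"
proof -
  let ?b = "fst s ''b''" and ?u = "fst s ''u''"
  let ?ys = "drop ?b xs"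
  have uy: "?u \<notin> set ?ys"
    using u by (auto dest: in_set_dropD)
  have card: "card (set ?ys \<union> {?u}) = Suc (length xs - ?b)"
    using uy d(1) by (simp add: distinct_card)
  have size: "card (set (output_list s)) = fst s ''size''"
    using distinct_card[OF d(2)] by (simp add: output_list_def)
  show ?thesis
  proof (cases "fst s ''size'' < Suc (length xs - ?b)")
    case False
    then show ?thesis
      unfolding card size using d(2) by (simp add: improve_def nv)
  next
    case True
    let ?s = "((fst s)(''size'' := Suc (length xs - ?b)), (snd s)(''out'' := (snd s ''out'')(0 := ?u)))"
    have "wp (copy 1) (\<lambda>t s'. distinct (output_list s') \<and> set (output_list s') = set ?ys \<union> {?u} \<and>
        t \<le> 50 * length xs + 20) ?s"
    proof (rule wp_conseq_frame[OF wp_copy])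
      fix t and s' :: state
      assume post: "(\<forall>j<fst ?s ''nv'' - fst ?s ''b''. snd s' ''out'' (j + 1) = snd ?s ''O'' (fst ?s ''b'' + j)) \<and>
          (\<forall>j<1. snd s' ''out'' j = snd ?s ''out'' j) \<and> t \<le> 50 * fst ?s ''nv'' + 20"
        and regs: "\<And>x. x \<notin> mod_regs (copy 1) \<Longrightarrow> fst s' x = fst ?s x"
      have "output_list s' = ?u # ?ys"
      proof (rule nth_equalityI)
        show "length (output_list s') = length (?u # ?ys)"
          by (simp add: output_list_def regs mod_copy)
      next
        fix j assume "j < length (output_list s')"
        then have "j < Suc (length xs - ?b)"
          by (simp add: output_list_def regs mod_copy)
        then show "output_list s' ! j = (?u # ?ys) ! j"
          using post O b by (cases j) (simp_all add: output_list_def regs mod_copy nv del: upt_Suc)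
      qed
      then show "distinct (output_list s') \<and> set (output_list s') = set ?ys \<union> {?u} \<and>
          t \<le> 50 * length xs + 20"
        using uy d(1) post by (simp add: nv)
    qed
    then have "wp (copy 1) (\<lambda>t s'. distinct (output_list s') \<and> set (output_list s') = set ?ys \<union> {?u} \<and>
        t + 20 \<le> 50 * length xs + 50) ?s"
      by (rule wp_conseq_frame) simp
    then show ?thesis
      unfolding card size using True
      by (simp add: improve_def nv) (erule wp_conseq_frame, simp)
  qed
qed

context ordered_graph
begin

text \<open>The marks, at most \<open>u\<close> before and at most \<open>u + 1\<close> after, are
  what the next call needs instead of cleared memory.\<close>

lemma wp_body:
  assumes inp: "input ns k s" and stored: "later_stored (length ns) s"
    and u: "fst s ''u'' = u" "u < length ns" and M: "\<forall>w. snd s ''M'' w \<le> u"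
    and out: "distinct (output_list s)"
  shows "wp body (\<lambda>t s'. (\<exists>C. Degen (induced G (later_neighbors G os u)) k C \<and>
        set (output_list s') = (if card (C \<union> {u}) > card (set (output_list s))
          then C \<union> {u} else set (output_list s))) \<and>
      distinct (output_list s') \<and> (\<forall>w. snd s' ''M'' w \<le> Suc u) \<and>
      t \<le> 1000 * (length (later u) * degeneracy G) + 1000) s"
proof -
  let ?vs = "later u" and ?\<delta> = "degeneracy G" and ?g = "induced G (set (later u))"
  have g: "?g = induced G (later_neighbors G os u)" and dist: "distinct ?vs"
    using later[OF u(2)] by simp_all
  have simple_g: "simple_graph ?g"
    using simple_graph_induced[OF simple later_subset[OF u(2)]] .
  have u_notin: "u \<notin> set ?vs"
    using later(2)[OF u(2)] later_neighbors_asym[OF os(1), of u G u] by auto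
  \<comment> \<open>If \<open>?\<delta>\<close> is 0 the list is empty; otherwise the factor is at
    least 1. This absorbs all costs linear in \<open>|N\<^sup>+(u)|\<close>.\<close>
  have d_le: "length ?vs \<le> length ?vs * ?\<delta>"
    using length_later_le[OF u(2)] by (cases "?\<delta>") auto
  \<comment> \<open>The subgraph has at most \<delta>(G) vertices, which bounds each of its
    degrees.\<close>
  have "(\<Sum>v\<in>set ?vs. deg ?g v) \<le> (\<Sum>v\<in>set ?vs. ?\<delta>)"
  proof (rule sum_mono)
    fix v assume "v \<in> set ?vs"
    then have "deg ?g v < length ?vs"
      using deg_less_card[OF simple_g, of v] dist by (simp add: distinct_card)
    then show "deg ?g v \<le> ?\<delta>"
      using length_later_le[OF u(2)] by simp
  qed
  then have deg_le: "(\<Sum>v\<in>set ?vs. deg ?g v) \<le> length ?vs * ?\<delta>"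
    using dist by (simp add: distinct_card)
  let ?Q = "\<lambda>t s'. (\<exists>C. Degen ?g k C \<and>
        set (output_list s') = (if card (C \<union> {u}) > card (set (output_list s))
          then C \<union> {u} else set (output_list s))) \<and>
      distinct (output_list s') \<and> (\<forall>w. snd s' ''M'' w \<le> Suc u) \<and>
      t \<le> 1000 * (length ?vs * ?\<delta>) + 1000"
  show ?thesis
    unfolding body_def wp_Seq g[symmetric]
  proof (rule wp_conseq_frame[OF wp_local_vertices[OF inp stored u M]])
    fix t1 and s1 :: state
    assume post1: "fst s1 ''nv'' = length ?vs \<and>
      (\<forall>i<length ?vs. snd s1 ''V'' i = ?vs ! i \<and>
        snd s1 ''S'' (?vs ! i) = i * length ?vs \<and> snd s1 ''L'' (?vs ! i) = 0) \<and>
      (\<forall>w. snd s1 ''M'' w \<le> Suc u \<and> (u < snd s1 ''M'' w \<longleftrightarrow> w \<in> set ?vs)) \<and>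
      t1 \<le> 60 * length ?vs + 20"
      and regs1: "\<And>x. x \<notin> mod_regs local_vertices \<Longrightarrow> fst s1 x = fst s x"
      and arrays1: "\<And>X. X \<notin> mod_arrays local_vertices \<Longrightarrow> snd s1 X = snd s X"
    have inp1: "input ns k s1"
      by (rule input_cong[OF inp]) (simp_all add: regs1 arrays1 mod_local_vertices)
    have stored1: "later_stored (length ns) s1"
      using stored by (simp add: later_stored_def arrays1 mod_local_vertices)
    have u1: "fst s1 ''u'' = u" and k1: "fst s1 ''k'' = k"
      using u inp by (simp_all add: regs1 mod_local_vertices input_def)
    have out1: "output_list s1 = output_list s"
      by (simp add: output_list_def regs1 arrays1 mod_local_vertices)
    show "wp local_edges (\<lambda>t s'. wp degen (\<lambda>x s'. wp improve
        (\<lambda>y. ?Q (t1 + (t + (x + y)))) s') s') s1"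
    proof (rule wp_conseq_frame[OF wp_local_edges[OF inp1 stored1 u(2) refl]])
      fix t2 and s2 :: state
      assume post2: "(\<exists>F. stored_graph ?g ?vs F s2) \<and> t2 \<le> length ?vs * (60 * ?\<delta> + 60) + 20"
        and regs2: "\<And>x. x \<notin> mod_regs local_edges \<Longrightarrow> fst s2 x = fst s1 x"
        and arrays2: "\<And>X. X \<notin> mod_arrays local_edges \<Longrightarrow> snd s2 X = snd s1 X"
      then obtain F where F: "stored_graph ?g ?vs F s2" by blast
      show "wp degen (\<lambda>x s'. wp improve (\<lambda>y. ?Q (t1 + (t2 + (x + y)))) s') s2"
      proof (rule wp_conseq_frame[OF wp_degen[OF simple_g F]])
        fix t3 and s3 :: state
        assume post3: "(\<exists>xs. degeneracy_ordering ?g xs \<and> length xs = length ?vs \<and>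
            (\<forall>j<length ?vs. snd s3 ''O'' j = xs ! j) \<and> fst s3 ''b'' \<le> length ?vs \<and>
            Degen ?g (fst s2 ''k'') (set (drop (fst s3 ''b'') xs))) \<and>
          t3 \<le> 500 * length ?vs + 200 * (\<Sum>v\<in>verts ?g. deg ?g v) + 100"
          and regs3: "\<And>x. x \<notin> mod_regs degen \<Longrightarrow> fst s3 x = fst s2 x"
          and arrays3: "\<And>X. X \<notin> mod_arrays degen \<Longrightarrow> snd s3 X = snd s2 X"
        then obtain xs where xs: "degeneracy_ordering ?g xs" "length xs = length ?vs"
          "\<forall>j<length xs. snd s3 ''O'' j = xs ! j" "fst s3 ''b'' \<le> length xs"
          "Degen ?g k (set (drop (fst s3 ''b'') xs))"
          by (auto simp: regs2 mod_local_edges k1)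
        have u3: "fst s3 ''u'' = u" "fst s3 ''nv'' = length xs" "output_list s3 = output_list s"
          "snd s3 ''M'' = snd s1 ''M''"
          using post1 by (simp_all add: regs3 regs2 arrays3 arrays2 mod_degen mod_local_edges u1 xs(2)
              output_list_def out1[unfolded output_list_def])
        have dxs: "distinct xs" "set xs = set ?vs"
          using xs(1) by (auto simp: degeneracy_ordering_def)
        have "wp improve (\<lambda>t s'. distinct (output_list s') \<and>
          set (output_list s') =
            (if card (set (drop (fst s3 ''b'') xs) \<union> {fst s3 ''u''}) > card (set (output_list s3))
             then set (drop (fst s3 ''b'') xs) \<union> {fst s3 ''u''} else set (output_list s3)) \<and>
          t \<le> 50 * length xs + 50) s3"
          by (rule wp_improve) (use u3 xs dxs u_notin out in simp_all)
        then show "wp improve (\<lambda>y. ?Q (t1 + (t2 + (t3 + y)))) s3"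
        proof (rule wp_conseq_frame)
          fix t4 and s4 :: state
          assume post4: "distinct (output_list s4) \<and>
            set (output_list s4) =
              (if card (set (drop (fst s3 ''b'') xs) \<union> {fst s3 ''u''}) > card (set (output_list s3))
               then set (drop (fst s3 ''b'') xs) \<union> {fst s3 ''u''} else set (output_list s3)) \<and>
            t4 \<le> 50 * length xs + 50"
            and arrays4: "\<And>X. X \<notin> mod_arrays improve \<Longrightarrow> snd s4 X = snd s3 X"
          have M4: "\<forall>w. snd s4 ''M'' w \<le> Suc u"
            using post1 by (simp add: arrays4 mod_improve u3)
          have "t1 + (t2 + (t3 + t4)) \<le> 1000 * (length ?vs * ?\<delta>) + 1000"
          \<comment> \<open>The linear terms add up to 60 + 60 + 500 + 50 = 670 and the products to
            60 + 200, so 930 times the product in all.\<close>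
          proof -
            have "t1 \<le> 60 * length ?vs + 20" "t2 \<le> 60 * (length ?vs * ?\<delta>) + 60 * length ?vs + 20"
              "t3 \<le> 500 * length ?vs + 200 * (\<Sum>v\<in>set ?vs. deg ?g v) + 100"
              "t4 \<le> 50 * length ?vs + 50"
              using post1 post2 post3 post4 xs(2) by (simp_all add: add_mult_distrib2)
            then show ?thesis
              using deg_le d_le by linarith
          qed
          then show "?Q (t1 + (t2 + (t3 + t4))) s4"
            using post4 M4 xs(5) unfolding u3 by blast
        qed
      qed
    qed (use post1 u1 in simp_all)
  qed
qed

text \<open>Each later list is part of an adjacency list, so the degree sum is a bound; the factor 2
  goes into the constants.\<close>

lemma sum_length_later: "(\<Sum>v<length ns. length (later v)) \<le> 2 * card (edges G)"
proof -
  have "(\<Sum>v<length ns. length (later v)) \<le> (\<Sum>v<length ns. deg G v)"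
    using length_later_le_length length_nth by (intro sum_mono) (metis lessThan_iff)
  also have "\<dots> \<le> 2 * card (edges G)"
    using sum_deg_le[OF simple] by (simp add: verts)
  finally show ?thesis .
qed

text \<open>The vertices are visited as \<open>[0..<length ns]\<close>, one of the orders that
  \<open>Degen_opt\<close> admits. It makes the bound \<open>u\<close> on the marks grow in step
  with the loop, starting from zeroed memory.\<close>

lemma wp_main_loop:
  assumes inp: "input ns k s" and stored: "later_stored (length ns) s"
    and M: "\<forall>w. snd s ''M'' w = 0"
    and out: "distinct (output_list s)" "Degen G k (set (output_list s))"
  shows "wp (For ''u'' (Reg ''n'') body) (\<lambda>t s'. distinct (output_list s') \<and>
     Degen_opt G k (set (output_list s')) \<and>
     t \<le> 2000 * (degeneracy G * card (edges G)) + 1010 * length ns + 10) s"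
proof -
  let ?C0 = "set (output_list s)"
  let ?T = "\<lambda>u. (\<Sum>v<u. 1000 * (length (later v) * degeneracy G)) + 1010 * u"
  define I where "I = (\<lambda>u t (s'::state). input ns k s' \<and> later_stored (length ns) s' \<and>
     (\<forall>w. snd s' ''M'' w \<le> u) \<and> distinct (output_list s') \<and>
     Degen_opt_loop G k os [0..<u] ?C0 (set (output_list s')) \<and> t \<le> ?T u)"
  have T: "?T (length ns) \<le> 2000 * (degeneracy G * card (edges G)) + 1010 * length ns"
  proof -
    have "(\<Sum>v<length ns. 1000 * (length (later v) * degeneracy G)) =
        1000 * degeneracy G * (\<Sum>v<length ns. length (later v))"
      by (simp add: sum_distrib_left sum_distrib_right ac_simps)
    also have "\<dots> \<le> 1000 * degeneracy G * (2 * card (edges G))"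
      by (rule mult_le_mono2[OF sum_length_later])
    finally show ?thesis by simp
  qed
  show ?thesis
  proof (rule wp_For[where I = I and N = "length ns" and M = "?T (length ns)"])
    have "input ns k ((fst s)(''u'' := 0), snd s)"
      "later_stored (length ns) ((fst s)(''u'' := 0), snd s)"
      "output_list ((fst s)(''u'' := 0), snd s) = output_list s"
      using inp stored by (simp_all add: input_def later_stored_def output_list_def)
    then show "I 0 0 ((fst s)(''u'' := 0), snd s)"
      using M out(1) by (simp add: I_def loop_Nil)
  next
    fix u t and s1 :: state
    assume I: "I u t s1" and u: "fst s1 ''u'' = u" "u < length ns"
    have I': "input ns k s1" "later_stored (length ns) s1" "\<forall>w. snd s1 ''M'' w \<le> u"
      "distinct (output_list s1)" "Degen_opt_loop G k os [0..<u] ?C0 (set (output_list s1))"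
      "t \<le> ?T u"
      using I by (simp_all add: I_def)
    show "wp body (\<lambda>x s'. I (Suc u) (7 + acost (Reg ''n'') + t + x) ((fst s')(''u'' := Suc u), snd s')) s1"
    proof (rule wp_conseq_frame[OF wp_body[OF I'(1,2) u I'(3,4)]])
      fix t2 and s2 :: state
      assume post: "(\<exists>C. Degen (induced G (later_neighbors G os u)) k C \<and>
        set (output_list s2) = (if card (C \<union> {u}) > card (set (output_list s1))
          then C \<union> {u} else set (output_list s1))) \<and>
        distinct (output_list s2) \<and> (\<forall>w. snd s2 ''M'' w \<le> Suc u) \<and>
        t2 \<le> 1000 * (length (later u) * degeneracy G) + 1000"
        and regs: "\<And>x. x \<notin> mod_regs body \<Longrightarrow> fst s2 x = fst s1 x"
        and arrays: "\<And>X. X \<notin> mod_arrays body \<Longrightarrow> snd s2 X = snd s1 X"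
      let ?s = "((fst s2)(''u'' := Suc u), snd s2)"
      obtain C where C: "Degen (induced G (later_neighbors G os u)) k C"
        "set (output_list s2) = (if card (C \<union> {u}) > card (set (output_list s1))
          then C \<union> {u} else set (output_list s1))"
        using post by blast
      have "input ns k ?s"
        by (rule input_cong[OF I'(1)]) (simp_all add: regs arrays mod_body)
      moreover have "later_stored (length ns) ?s"
        using I'(2) by (simp add: later_stored_def arrays mod_body)
      moreover have "output_list ?s = output_list s2"
        by (simp add: output_list_def)
      moreover have "Degen_opt_loop G k os [0..<Suc u] ?C0 (set (output_list s2))"
        using Degen_opt_loop_snoc[OF I'(5) C(1)] unfolding C(2) by simp
      moreover have "7 + acost (Reg ''n'') + t + t2 \<le> ?T (Suc u)"
        using post I'(6) by simp
      ultimately show "I (Suc u) (7 + acost (Reg ''n'') + t + t2) ?s"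
        using post unfolding I_def snd_conv by presburger
    qed
  next
    fix i t and s1 :: state
    assume "I i t s1" "i \<le> length ns"
    moreover from this have "(\<Sum>v<i. 1000 * (length (later v) * degeneracy G)) \<le>
        (\<Sum>v<length ns. 1000 * (length (later v) * degeneracy G))"
      by (intro sum_mono2) auto
    ultimately show "t \<le> ?T (length ns)"
      by (simp add: I_def)
  next
    fix t and s1 :: state
    assume I: "I (length ns) t s1"
    then have "Degen_opt G k (set (output_list s1))"
      using out(2) ordering verts unfolding Degen_opt_def I_def
      by (metis atLeast_upt distinct_upt)
    then show "distinct (output_list s1) \<and> Degen_opt G k (set (output_list s1)) \<and>
        5 + acost (Reg ''n'') + t
          \<le> 2000 * (degeneracy G * card (edges G)) + 1010 * length ns + 10"
      using I T unfolding I_def by simp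
  qed (auto simp: I_def input_def mod_body)
qed

end

lemma wp_degen_opt:
  assumes G: "simple_graph G" "adjacency_lists G ns"
  shows "wp degen_opt (\<lambda>t s'. distinct (output_list s') \<and> Degen_opt G k (set (output_list s')) \<and>
     t \<le> 3000 * (degeneracy G * card (edges G) + card (verts G) + 1)) (input_state ns k)"
proof -
  let ?s0 = "input_state ns k" and ?n = "length ns"
  let ?m = "length (concat ns)"
  let ?Q = "\<lambda>t s'. distinct (output_list s') \<and> Degen_opt G k (set (output_list s')) \<and>
     t \<le> 3000 * (degeneracy G * card (edges G) + card (verts G) + 1)"
  have vG: "verts G = {..<?n}"
    using G(2) by (simp add: adjacency_lists_def)
  have inp0: "input ns k ?s0" by (rule input_input_state)
  show ?thesis
    unfolding degen_opt_def wp_Seq wp_Assign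
  proof (rule wp_conseq_frame[OF wp_load[OF inp0]])
    fix t1 and s1 :: state
    assume post1: "fst s1 ''nv'' = ?n \<and>
      (\<forall>v<?n. snd s1 ''V'' v = v \<and> snd s1 ''L'' v = length (ns ! v) \<and>
        (\<forall>j<length (ns ! v). snd s1 ''A'' (snd s1 ''S'' v + j) = ns ! v ! j)) \<and>
      t1 \<le> 50 * ?n + 50 * ?m + 50"
      and regs1: "\<And>x. x \<notin> mod_regs load \<Longrightarrow> fst s1 x = fst ?s0 x"
      and arrays1: "\<And>X. X \<notin> mod_arrays load \<Longrightarrow> snd s1 X = snd ?s0 X"
    have inp1: "input ns k s1"
      by (rule input_cong[OF inp0]) (simp_all add: regs1 arrays1 mod_load)
    have M1: "\<forall>w. snd s1 ''M'' w = 0"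
      by (simp add: arrays1 mod_load input_state_def)
    have "stored_graph G [0..<?n] (\<lambda>v. ns ! v) s1"
      using post1 G(2) by (auto simp: stored_graph_def adjacency_lists_def)
    then show "wp degen (\<lambda>t s'. wp (copy 0) (\<lambda>x s'. wp positions (\<lambda>y s'. wp later_lists (\<lambda>z s'.
        wp (For ''u'' (Reg ''n'') body)
          (\<lambda>u. ?Q (t1 + (t + (1 + acost (Sub (Reg ''nv'') (Reg ''b'')) + (x + (y + (z + u))))))) s') s') s')
        ((fst s')(''size'' := aval (Sub (Reg ''nv'') (Reg ''b'')) s'), snd s')) s1"
    proof (rule wp_conseq_frame[OF wp_degen[OF G(1)]])
      fix t2 and s2 :: state
      assume post2: "(\<exists>os. degeneracy_ordering G os \<and> length os = length [0..<?n] \<and>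
          (\<forall>j<length [0..<?n]. snd s2 ''O'' j = os ! j) \<and> fst s2 ''b'' \<le> length [0..<?n] \<and>
          Degen G (fst s1 ''k'') (set (drop (fst s2 ''b'') os))) \<and>
        t2 \<le> 500 * length [0..<?n] + 200 * (\<Sum>v\<in>verts G. deg G v) + 100"
        and regs2: "\<And>x. x \<notin> mod_regs degen \<Longrightarrow> fst s2 x = fst s1 x"
        and arrays2: "\<And>X. X \<notin> mod_arrays degen \<Longrightarrow> snd s2 X = snd s1 X"
      then obtain os where ord: "degeneracy_ordering G os" "length os = ?n"
          "\<forall>j<length os. snd s2 ''O'' j = os ! j" "fst s2 ''b'' \<le> length os"
          "Degen G k (set (drop (fst s2 ''b'') os))"
        using inp1 by (auto simp: input_def)
      \<comment> \<open>The ordering behind the initial solution is used for the loop as well;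
        \<open>Degen_opt\<close> leaves both choices open.\<close>
      interpret ordered_graph G ns k os
        using G ord(1) by unfold_locales
      let ?b = "fst s2 ''b''"
      let ?s2 = "((fst s2)(''size'' := aval (Sub (Reg ''nv'') (Reg ''b'')) s2), snd s2)"
      have dos: "distinct os"
        using ord(1) by (simp add: degeneracy_ordering_def)
      have nv2: "fst s2 ''nv'' = ?n"
        using post1 by (simp add: regs2 mod_degen)
      show "wp (copy 0) (\<lambda>x s'. wp positions (\<lambda>y s'. wp later_lists (\<lambda>z s'.
        wp (For ''u'' (Reg ''n'') body)
          (\<lambda>u. ?Q (t1 + (t2 + (1 + acost (Sub (Reg ''nv'') (Reg ''b'')) + (x + (y + (z + u))))))) s') s') s')
        ?s2"
      proof (rule wp_conseq_frame[OF wp_copy])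
        fix t3 and s3 :: state
        assume post3: "(\<forall>j<fst ?s2 ''nv'' - fst ?s2 ''b''. snd s3 ''out'' (j + 0) = snd ?s2 ''O'' (fst ?s2 ''b'' + j)) \<and>
            (\<forall>j<0. snd s3 ''out'' j = snd ?s2 ''out'' j) \<and> t3 \<le> 50 * fst ?s2 ''nv'' + 20"
          and regs3: "\<And>x. x \<notin> mod_regs (copy 0) \<Longrightarrow> fst s3 x = fst ?s2 x"
          and arrays3: "\<And>X. X \<notin> mod_arrays (copy 0) \<Longrightarrow> snd s3 X = snd ?s2 X"
        have out3: "output_list s3 = drop ?b os"
          using post3 ord(2-4)
          by (intro nth_equalityI) (simp_all add: output_list_def regs3 mod_copy nv2)
        have pos: "fst s3 ''nv'' = length os" "\<forall>j<length os. snd s3 ''O'' j = os ! j"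
          using ord(2,3) by (simp_all add: regs3 arrays3 mod_copy nv2)
        show "wp positions (\<lambda>y s'. wp later_lists (\<lambda>z s'. wp (For ''u'' (Reg ''n'') body)
          (\<lambda>u. ?Q (t1 + (t2 + (1 + acost (Sub (Reg ''nv'') (Reg ''b'')) + (t3 + (y + (z + u))))))) s') s') s3"
        proof (rule wp_conseq_frame[OF wp_positions[OF pos(1) dos pos(2)]])
          fix t4 and s4 :: state
          assume post4: "(\<forall>j<length os. snd s4 ''P'' (os ! j) = j) \<and> t4 \<le> 50 * length os + 20"
            and regs4: "\<And>x. x \<notin> mod_regs positions \<Longrightarrow> fst s4 x = fst s3 x"
            and arrays4: "\<And>X. X \<notin> mod_arrays positions \<Longrightarrow> snd s4 X = snd s3 X"
          have inp4: "input ns k s4"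
            by (rule input_cong[OF inp1])
              (simp_all add: regs4 regs3 regs2 arrays4 arrays3 arrays2 mod_positions mod_copy mod_degen)
          show "wp later_lists (\<lambda>z s'. wp (For ''u'' (Reg ''n'') body)
            (\<lambda>u. ?Q (t1 + (t2 + (1 + acost (Sub (Reg ''nv'') (Reg ''b'')) + (t3 + (t4 + (z + u))))))) s') s4"
          proof (rule wp_conseq_frame[OF wp_later_lists[OF inp4 conjunct1[OF post4]]])
            fix t5 and s5 :: state
            assume post5: "later_stored ?n s5 \<and> t5 \<le> 60 * ?n + 60 * ?m + 20"
              and regs5: "\<And>x. x \<notin> mod_regs later_lists \<Longrightarrow> fst s5 x = fst s4 x"
              and arrays5: "\<And>X. X \<notin> mod_arrays later_lists \<Longrightarrow> snd s5 X = snd s4 X"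
            have inp5: "input ns k s5"
              by (rule input_cong[OF inp4]) (simp_all add: regs5 arrays5 mod_later_lists)
            have M5: "\<forall>w. snd s5 ''M'' w = 0"
              using M1 by (simp add: arrays5 arrays4 arrays3 arrays2 mod_later_lists mod_positions
                  mod_copy mod_degen)
            have out5: "output_list s5 = drop ?b os"
              unfolding out3[symmetric]
              by (simp add: output_list_def regs5 regs4 arrays5 arrays4 mod_later_lists mod_positions)
            have "wp (For ''u'' (Reg ''n'') body) (\<lambda>t s'. distinct (output_list s') \<and>
               Degen_opt G k (set (output_list s')) \<and>
               t \<le> 2000 * (degeneracy G * card (edges G)) + 1010 * ?n + 10) s5"
              by (rule wp_main_loop[OF inp5 _ M5]) (use post5 out5 dos ord(5) in simp_all)
            then show "wp (For ''u'' (Reg ''n'') body)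
              (\<lambda>u. ?Q (t1 + (t2 + (1 + acost (Sub (Reg ''nv'') (Reg ''b'')) + (t3 + (t4 + (t5 + u))))))) s5"
            proof (rule wp_conseq_frame)
              fix t6 and s6 :: state
              assume post6: "distinct (output_list s6) \<and> Degen_opt G k (set (output_list s6)) \<and>
                 t6 \<le> 2000 * (degeneracy G * card (edges G)) + 1010 * ?n + 10"
              \<comment> \<open>\<open>?m\<close> is the sum of the degrees. An edge forces
                \<delta>(G) \<ge> 1, and without edges the degree sum is 0.\<close>
              have m: "?m \<le> 2 * (degeneracy G * card (edges G))"
              proof (cases "edges G = {}")
                case True
                then show ?thesis
                  using sum_deg_le[OF G(1)] length_concat by simp
              next
                case False
                then have "card (edges G) \<le> degeneracy G * card (edges G)"
                  using mult_le_mono1[OF degeneracy_pos[OF G(1)], of "card (edges G)"]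
                  by (simp only: mult_1 not_False_eq_True)
                then show ?thesis
                  using sum_deg_le[OF G(1)] length_concat by linarith
              qed
              show "?Q (t1 + (t2 + (1 + acost (Sub (Reg ''nv'') (Reg ''b'')) +
                  (t3 + (t4 + (t5 + t6)))))) s6"
                \<comment> \<open>The coefficient of \<open>?m\<close> is 50 + 200 + 60 = 310, so
                  the product gets 2000 + 620 and the number of vertices 1720, both below
                  3000.\<close>
                using post1 post2 post3 post4 post5 post6 m length_concat nv2 ord(2) vG by simp
            qed
          qed
        qed
      qed
    qed
  qed
qed

text \<open>Without isolated vertices each vertex adds at least 1 to the degree sum. This removes
  the number of vertices from the final bound.\<close>

lemma card_verts_le:
  assumes "simple_graph G" "\<forall>v \<in> verts G. neighbors G v \<noteq> {}"
  shows "card (verts G) \<le> 2 * card (edges G)"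
proof -
  have "card (verts G) = (\<Sum>v\<in>verts G. 1)" by simp
  also have "\<dots> \<le> (\<Sum>v\<in>verts G. deg G v)"
    using assms finite_neighbors[OF assms(1)]
    by (intro sum_mono) (simp add: deg_def Suc_le_eq card_gt_0_iff)
  also have "\<dots> \<le> 2 * card (edges G)"
    by (rule sum_deg_le[OF assms(1)])
  finally show ?thesis .
qed

theorem mainTheorem5:
  "(\<forall>(G :: 'a ugraph) k C.
      simple_graph G \<and> 1 \<le> k \<and> Degen_opt G k C \<longrightarrow> defective_clique G k C)
   \<and>
   (\<exists>P (c :: nat). \<forall>(G :: nat ugraph) k ns.
      simple_graph G \<and> 1 \<le> k \<and> adjacency_lists G ns \<longrightarrow>
      (\<exists>t s. exec P (input_state ns k) t s \<and>
         distinct (output_list s) \<and>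
         Degen_opt G k (set (output_list s)) \<and>
         defective_clique G k (set (output_list s)) \<and>
         t \<le> c * (degeneracy G * card (edges G) + card (verts G) + 1) \<and>
         (verts G \<noteq> {} \<and> (\<forall>v \<in> verts G. neighbors G v \<noteq> {}) \<longrightarrow>
            t \<le> c * (degeneracy G * card (edges G)))))"
proof (rule conjI, intro allI impI, goal_cases)
  case (1 G k C)
  then show ?case
    by (blast intro: Degen_opt_defective_clique)
next
  case 2
  show ?case
  proof (rule exI[of _ degen_opt], rule exI[of _ 12000], intro allI impI)
    fix G :: "nat ugraph" and k :: nat and ns
    assume G: "simple_graph G \<and> 1 \<le> k \<and> adjacency_lists G ns"
    let ?\<delta>m = "degeneracy G * card (edges G)"
    obtain t s where run: "exec degen_opt (input_state ns k) t s" "distinct (output_list s)"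
      "Degen_opt G k (set (output_list s))" "t \<le> 3000 * (?\<delta>m + card (verts G) + 1)"
      using wp_degen_opt[of G ns k] G by (auto simp: wp_def)
    have "t \<le> 12000 * ?\<delta>m"
      if ne: "verts G \<noteq> {} \<and> (\<forall>v \<in> verts G. neighbors G v \<noteq> {})"
    proof -
      have n: "card (verts G) \<le> 2 * card (edges G)" "0 < card (verts G)"
        using G ne card_verts_le[of G] by (auto simp: simple_graph_def card_gt_0_iff)
      then have "edges G \<noteq> {}" by auto
      then have "card (edges G) \<le> ?\<delta>m"
        using mult_le_mono1[OF degeneracy_pos, of G "card (edges G)"] G
        by (simp only: mult_1 not_False_eq_True)
      moreover have "1 \<le> card (edges G)"
        using n by linarith
      \<comment> \<open>With \<open>c\<close> at most \<open>2 * x\<close> and \<open>x\<close> at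
        least 1, the bound is 3000 times x + 2x + x, whence the constant 12000.\<close>
      moreover have "t \<le> 12000 * x"
        if "t \<le> 3000 * (x + c + 1)" "c \<le> 2 * m" "m \<le> x" "1 \<le> m" for c m x
        using that by simp
      ultimately show ?thesis
        using run(4) n(1) by blast
    qed
    then show "\<exists>t s. exec degen_opt (input_state ns k) t s \<and> distinct (output_list s) \<and>
        Degen_opt G k (set (output_list s)) \<and> defective_clique G k (set (output_list s)) \<and>
        t \<le> 12000 * (?\<delta>m + card (verts G) + 1) \<and>
        (verts G \<noteq> {} \<and> (\<forall>v \<in> verts G. neighbors G v \<noteq> {}) \<longrightarrow> t \<le> 12000 * ?\<delta>m)"
      using run G Degen_opt_defective_clique[of G k "set (output_list s)"]
      by (intro exI[of _ t] exI[of _ s]) auto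
  qed
qed

end
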